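(* Let $R\subset S$ be an integral distributive FCP extension with $R$ a local ring. Then $$\ell[R,S]=\ell[R,{}_S^+R]+\ell[{}_S^tR,S]+|\mathrm{Max}(S)|-1.$$
   Context: All rings are commutative with unit; a local ring is a ring with a unique maximal ideal. $[R,S]$ denotes the set of all $R$-subalgebras of $S$, ordered by inclusion; it is a lattice with infimum $T\cap U$ and supremum the compositum $TU$. The extension $R\subseteq S$ is distributive if the lattice $[R,S]$ is distributive; it has FCP if every chain in $[R,S]$ is finite. The length $\ell[R,S]$ is the supremum of the lengths of chains in $[R,S]$, where a chain $R_0\subset\cdots\subset R_n$ has length $n$. An extension $B\subseteq S$ is t-closed if $b\in S$, $r\in B$, $b^2-rb\in B$, $b^3-rb^2\in B$ imply $b\in B$; it is seminormal if $b\in S$, $b^2\in B$, $b^3\in B$ imply $b\in B$. The t-closure ${}_S^tR$ (resp. seminormalization ${}_S^+R$) of $R$ in $S$ is the smallest $B\in[R,S]$ such that $B\subseteq S$ is t-closed (resp. seminormal). *)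

theory Defs
  imports "HOL-Algebra.Algebra" "HOL-Library.Extended_Nat"
begin

text \<open>
  A ring extension is a commutative ring \<open>S\<close> (a record) together with a subring \<open>R\<close> of \<open>S\<close>
  (a subset of the carrier).  For \<open>B\<close> a subring of \<open>S\<close>, the ring \<open>B\<close> itself is the record
  \<open>S\<lparr>carrier := B\<rparr>\<close>; in particular the extension \<open>R \<subseteq> B\<close> is given by \<open>R\<close> and \<open>S\<lparr>carrier := B\<rparr>\<close>.
\<close>

definition local_ring :: "('a, 'b) ring_scheme \<Rightarrow> bool" where
  "local_ring A \<longleftrightarrow> cring A \<and> (\<exists>!M. maximalideal M A)"

definition Max_spec :: "('a, 'b) ring_scheme \<Rightarrow> 'a set set" where
  "Max_spec A = {M. maximalideal M A}"

definition subalgebras :: "'a set \<Rightarrow> ('a, 'b) ring_scheme \<Rightarrow> 'a set set" where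
  "subalgebras R S = {T. subring T S \<and> R \<subseteq> T}"

definition compositum :: "('a, 'b) ring_scheme \<Rightarrow> 'a set \<Rightarrow> 'a set \<Rightarrow> 'a set" where
  "compositum S T U = generate_ring S (T \<union> U)"

definition distributive_extension :: "'a set \<Rightarrow> ('a, 'b) ring_scheme \<Rightarrow> bool" where
  "distributive_extension R S \<longleftrightarrow>
     (\<forall>T\<in>subalgebras R S. \<forall>U\<in>subalgebras R S. \<forall>V\<in>subalgebras R S.
        T \<inter> compositum S U V = compositum S (T \<inter> U) (T \<inter> V))"

definition FCP_extension :: "'a set \<Rightarrow> ('a, 'b) ring_scheme \<Rightarrow> bool" where
  "FCP_extension R S \<longleftrightarrow> (\<forall>C. subset.chain (subalgebras R S) C \<longrightarrow> finite C)"

text \<open>The condition \<open>p \<noteq> []\<close> is there because \<open>lead_coeff []\<close> is unspecified.\<close>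

definition integral_extension :: "'a set \<Rightarrow> ('a, 'b) ring_scheme \<Rightarrow> bool" where
  "integral_extension R S \<longleftrightarrow>
     (\<forall>x\<in>carrier S. \<exists>p\<in>carrier (R[X]\<^bsub>S\<^esub>).
        p \<noteq> [] \<and> lead_coeff p = \<one>\<^bsub>S\<^esub> \<and> ring.eval S p x = \<zero>\<^bsub>S\<^esub>)"

definition extension_length :: "'a set \<Rightarrow> ('a, 'b) ring_scheme \<Rightarrow> enat" where
  "extension_length R S =
     Sup {enat n | n. \<exists>T :: nat \<Rightarrow> 'a set.
            (\<forall>i\<le>n. T i \<in> subalgebras R S) \<and> (\<forall>i<n. T i \<subset> T (Suc i))}"

text \<open>Cardinality without the convention that infinite sets have cardinality \<open>0\<close>.\<close>

definition ecard :: "'a set \<Rightarrow> enat" where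
  "ecard A = (if finite A then enat (card A) else \<infinity>)"

definition t_closed :: "'a set \<Rightarrow> ('a, 'b) ring_scheme \<Rightarrow> bool" where
  "t_closed B S \<longleftrightarrow>
     (\<forall>b\<in>carrier S. \<forall>r\<in>B.
        b [^]\<^bsub>S\<^esub> (2::nat) \<ominus>\<^bsub>S\<^esub> r \<otimes>\<^bsub>S\<^esub> b \<in> B \<longrightarrow>
        b [^]\<^bsub>S\<^esub> (3::nat) \<ominus>\<^bsub>S\<^esub> r \<otimes>\<^bsub>S\<^esub> b [^]\<^bsub>S\<^esub> (2::nat) \<in> B \<longrightarrow> b \<in> B)"

definition seminormal :: "'a set \<Rightarrow> ('a, 'b) ring_scheme \<Rightarrow> bool" where
  "seminormal B S \<longleftrightarrow>
     (\<forall>b\<in>carrier S. b [^]\<^bsub>S\<^esub> (2::nat) \<in> B \<longrightarrow> b [^]\<^bsub>S\<^esub> (3::nat) \<in> B \<longrightarrow> b \<in> B)"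

definition t_closure :: "'a set \<Rightarrow> ('a, 'b) ring_scheme \<Rightarrow> 'a set" where
  "t_closure R S = (LEAST B. B \<in> subalgebras R S \<and> t_closed B S)"

definition seminormalization :: "'a set \<Rightarrow> ('a, 'b) ring_scheme \<Rightarrow> 'a set" where
  "seminormalization R S = (LEAST B. B \<in> subalgebras R S \<and> seminormal B S)"

text \<open>Both least elements exist, so \<open>LEAST\<close> is meaningful: they are intersections.\<close>

lemma subalgebras_Inter:
  assumes "ring S" and "F \<subseteq> subalgebras R S" and "F \<noteq> {}"
  shows "\<Inter>F \<in> subalgebras R S"
proof -
  interpret ring S by fact
  have sub: "subring T S" "R \<subseteq> T" if "T \<in> F" for T
    using that assms(2) by (auto simp: subalgebras_def)
  have "subring (\<Inter>F) S"
    using sub(1) assms(3) by (intro subringI) (auto dest: subringE)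
  then show ?thesis
    using sub(2) by (auto simp: subalgebras_def)
qed

lemma least_subalgebra:
  assumes "ring S" and "subring R S" and "P (carrier S)"
    and inter: "\<And>F. F \<noteq> {} \<Longrightarrow> F \<subseteq> Collect P \<Longrightarrow> P (\<Inter>F)"
  defines "L \<equiv> LEAST B. B \<in> subalgebras R S \<and> P B"
  shows "L \<in> subalgebras R S" and "P L"
    and "B \<in> subalgebras R S \<Longrightarrow> P B \<Longrightarrow> L \<subseteq> B"
proof -
  define F where "F = {B. B \<in> subalgebras R S \<and> P B}"
  have "carrier S \<in> F"
    using assms(1-3) ring.carrier_is_subring subringE(1) by (auto simp: F_def subalgebras_def)
  then have "F \<noteq> {}" by auto
  then have F: "\<Inter>F \<in> subalgebras R S" "P (\<Inter>F)"
    using assms(1) by (auto intro!: subalgebras_Inter inter simp: F_def)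
  have "L = \<Inter>F"
    unfolding L_def using F by (intro Least_equality) (auto simp: F_def)
  then show "L \<in> subalgebras R S" "P L"
    and "B \<in> subalgebras R S \<Longrightarrow> P B \<Longrightarrow> L \<subseteq> B"
    using F by (auto simp: F_def)
qed

lemma t_closure_least:
  assumes "ring S" and "subring R S"
  shows "t_closure R S \<in> subalgebras R S" and "t_closed (t_closure R S) S"
    and "B \<in> subalgebras R S \<Longrightarrow> t_closed B S \<Longrightarrow> t_closure R S \<subseteq> B"
proof -
  have c: "t_closed (carrier S) S"
    by (auto simp: t_closed_def)
  have i: "t_closed (\<Inter>F) S" if "F \<noteq> {}" "F \<subseteq> Collect (\<lambda>B. t_closed B S)" for F
    unfolding t_closed_def
  proof (intro ballI impI InterI)
    fix b r B
    assume "b \<in> carrier S" "r \<in> \<Inter>F" "B \<in> F"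
      and "b [^]\<^bsub>S\<^esub> (2::nat) \<ominus>\<^bsub>S\<^esub> r \<otimes>\<^bsub>S\<^esub> b \<in> \<Inter>F"
        "b [^]\<^bsub>S\<^esub> (3::nat) \<ominus>\<^bsub>S\<^esub> r \<otimes>\<^bsub>S\<^esub> b [^]\<^bsub>S\<^esub> (2::nat) \<in> \<Inter>F"
    moreover have "t_closed B S"
      using that \<open>B \<in> F\<close> by auto
    ultimately show "b \<in> B"
      unfolding t_closed_def by (meson InterD)
  qed
  show "t_closure R S \<in> subalgebras R S"
    unfolding t_closure_def by (rule least_subalgebra(1)[OF assms]) (use c i in auto)
  show "t_closed (t_closure R S) S"
    unfolding t_closure_def by (rule least_subalgebra(2)[OF assms]) (use c i in auto)
  show "t_closure R S \<subseteq> B" if "B \<in> subalgebras R S" "t_closed B S"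
    unfolding t_closure_def
    by (rule least_subalgebra(3)[OF assms, where P = "\<lambda>B. t_closed B S"]) (use c i that in auto)
qed

lemma seminormalization_least:
  assumes "ring S" and "subring R S"
  shows "seminormalization R S \<in> subalgebras R S" and "seminormal (seminormalization R S) S"
    and "B \<in> subalgebras R S \<Longrightarrow> seminormal B S \<Longrightarrow> seminormalization R S \<subseteq> B"
proof -
  have c: "seminormal (carrier S) S"
    by (auto simp: seminormal_def)
  have i: "seminormal (\<Inter>F) S" if "F \<noteq> {}" "F \<subseteq> Collect (\<lambda>B. seminormal B S)" for F
    unfolding seminormal_def
  proof (intro ballI impI InterI)
    fix b B
    assume "b \<in> carrier S" "B \<in> F"
      and "b [^]\<^bsub>S\<^esub> (2::nat) \<in> \<Inter>F"
        "b [^]\<^bsub>S\<^esub> (3::nat) \<in> \<Inter>F"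
    moreover have "seminormal B S"
      using that \<open>B \<in> F\<close> by auto
    ultimately show "b \<in> B"
      unfolding seminormal_def by (meson InterD)
  qed
  show "seminormalization R S \<in> subalgebras R S"
    unfolding seminormalization_def by (rule least_subalgebra(1)[OF assms]) (use c i in auto)
  show "seminormal (seminormalization R S) S"
    unfolding seminormalization_def by (rule least_subalgebra(2)[OF assms]) (use c i in auto)
  show "seminormalization R S \<subseteq> B" if "B \<in> subalgebras R S" "seminormal B S"
    unfolding seminormalization_def
    by (rule least_subalgebra(3)[OF assms, where P = "\<lambda>B. seminormal B S"]) (use c i that in auto)
qed

end

theory Submission
  imports Defs
begin

text \<open>
  Let \<open>J\<close> be the Jacobson radical of \<open>S\<close>, \<open>A\<close> the seminormalization and \<open>T\<close> the t-closure of \<open>R\<close>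
  in \<open>S\<close>.  Since t-closed implies seminormal, \<open>R \<subseteq> A \<subseteq> T \<subseteq> S\<close>.  In a distributive lattice lengths add
  along such a tower (\<open>extension_length_additive\<close>), so the formula amounts to
  \<open>\<ell>[A,T] + 1 = \<bar>Max(S)\<bar>\<close> (\<open>extension_length_seminormalization_t_closure\<close>).

  The first point is that \<open>A = R + J\<close> (\<open>seminormalization_eq\<close>).  By integrality and locality every
  maximal ideal of \<open>S\<close> contracts to the maximal ideal \<open>P = R \<inter> J\<close> of \<open>R\<close>, so \<open>(R + J) / J\<close> is the field
  \<open>R / P\<close> inside the reduced ring \<open>S / J\<close>; this makes \<open>R + J\<close> seminormal and gives \<open>A \<subseteq> R + J\<close>.  For the
  converse, let \<open>x\<close> be an element of \<open>J\<close>.  The chain condition for the subalgebras \<open>R + x\<^sup>i S\<close> puts some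
  power of \<open>x\<close> into \<open>P S\<close>.  The chain condition for \<open>R + m\<^sup>i R[b]\<close>, with \<open>m \<in> P\<close> and \<open>b \<in> S\<close>, combined with
  Nakayama's lemma, puts \<open>m\<^sup>i R[b]\<close> into \<open>R\<close> for some \<open>i\<close>.  So high powers of
  \<open>m b\<close> lie in \<open>R\<close>, and in a seminormal subalgebra membership descends from high powers to the element:
  \<open>P S \<subseteq> A\<close>.  Then high powers of \<open>x\<close> lie in \<open>A\<close>, and in the same way \<open>J \<subseteq> A\<close>.

  The same chain \<open>R + x\<^sup>i S\<close>, for \<open>x\<close> in one maximal ideal but not in another, yields an idempotent of
  \<open>S / J\<close> that separates the two.  Three maximal ideals would give nonzero orthogonal idempotents \<open>e\<close>,
  \<open>f\<close> of \<open>S / J\<close> whose sum is not \<open>1\<close>, and then the subalgebras generated by \<open>e\<close>, by \<open>f\<close> and by \<open>e + f\<close> over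
  \<open>R + J\<close> have pairwise intersection \<open>R + J\<close> while each lies in the compositum of the other two.  This
  contradicts distributivity, so \<open>S\<close> has at most two maximal ideals (\<open>no_three_maximalideals\<close>).

  Finally \<open>R + N\<close> is t-closed for each maximal ideal \<open>N\<close>, because \<open>(R + N) / N\<close> and \<open>S / N\<close> are fields.
  So \<open>T\<close> is contained in the intersection of the \<open>R + N\<close>.  If there is one maximal ideal this
  intersection is \<open>R + J = A\<close>.  If there are two, it is \<open>R + R e + J\<close> with \<open>e\<close> a separating idempotent;
  since \<open>e\<close> lies in every t-closed subalgebra containing \<open>J\<close>, this is \<open>T\<close>, and it covers \<open>A\<close> because \<open>R / P\<close>
  is a field.
\<close>

section \<open>Lengths of lattices of subalgebras\<close>

definition strict_chain :: "'a set set \<Rightarrow> (nat \<Rightarrow> 'a set) \<Rightarrow> nat \<Rightarrow> bool" where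
  "strict_chain L T n \<longleftrightarrow> (\<forall>i\<le>n. T i \<in> L) \<and> (\<forall>i<n. T i \<subset> T (Suc i))"

lemma strict_chain_length_le:
  "strict_chain (subalgebras R S) T n \<Longrightarrow> enat n \<le> extension_length R S"
  unfolding extension_length_def strict_chain_def by (intro Sup_upper) auto

lemma extension_length_leI:
  assumes "\<And>T n. strict_chain (subalgebras R S) T n \<Longrightarrow> enat n \<le> x"
  shows "extension_length R S \<le> x"
  unfolding extension_length_def using assms by (intro Sup_least) (auto simp: strict_chain_def)

text \<open>
  Dropping the repetitions of a weakly increasing chain leaves a strict chain. The last term is kept
  in the statement because the next strict step is attached to it.
\<close>

lemma strict_chain_of_weak_chain:
  assumes "\<And>i. i \<le> n \<Longrightarrow> T i \<in> L" and "\<And>i. i < n \<Longrightarrow> T i \<subseteq> T (Suc i)"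
  shows "\<exists>U. strict_chain L U (card {i. i < n \<and> T i \<noteq> T (Suc i)})
           \<and> U (card {i. i < n \<and> T i \<noteq> T (Suc i)}) = T n"
  using assms
proof (induction n)
  case 0
  then show ?case
    by (intro exI[of _ "\<lambda>_. T 0"]) (auto simp: strict_chain_def)
next
  case (Suc n)
  define k where "k = card {i. i < n \<and> T i \<noteq> T (Suc i)}"
  obtain U where U: "strict_chain L U k" "U k = T n"
    using Suc.IH[OF Suc.prems] unfolding k_def by auto
  show ?case
  proof (cases "T n = T (Suc n)")
    case True
    then have "{i. i < Suc n \<and> T i \<noteq> T (Suc i)} = {i. i < n \<and> T i \<noteq> T (Suc i)}"
      by (auto simp: less_Suc_eq)
    then show ?thesis
      using U True unfolding k_def by auto
  next
    case False
    then have "{i. i < Suc n \<and> T i \<noteq> T (Suc i)} = insert n {i. i < n \<and> T i \<noteq> T (Suc i)}"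
      by (auto simp: less_Suc_eq)
    then have card: "card {i. i < Suc n \<and> T i \<noteq> T (Suc i)} = Suc k"
      unfolding k_def by simp
    have "strict_chain L (U(Suc k := T (Suc n))) (Suc k)"
      using U False Suc.prems(1)[of "Suc n"] Suc.prems(2)[of n]
      by (auto simp: strict_chain_def less_Suc_eq le_Suc_eq)
    moreover have "(U(Suc k := T (Suc n))) (Suc k) = T (Suc n)" by simp
    ultimately show ?thesis
      unfolding card by blast
  qed
qed

lemma weak_chain_length_le:
  assumes "\<And>i. i \<le> n \<Longrightarrow> T i \<in> subalgebras R S" and "\<And>i. i < n \<Longrightarrow> T i \<subseteq> T (Suc i)"
  shows "enat (card {i. i < n \<and> T i \<noteq> T (Suc i)}) \<le> extension_length R S"
proof -
  have "\<exists>U. strict_chain (subalgebras R S) U (card {i. i < n \<and> T i \<noteq> T (Suc i)})"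
    using strict_chain_of_weak_chain[of n T "subalgebras R S"] assms by blast
  then show ?thesis
    using strict_chain_length_le by blast
qed

text \<open>
  Suprema of nonempty sets of extended naturals are attained as soon as they are finite, and here a
  finite bound \<open>z\<close> on the sums forces both to be finite.
\<close>

lemma Sup_enat_add_le:
  fixes E F :: "enat set"
  assumes "E \<noteq> {}" "F \<noteq> {}" and le: "\<And>x y. x \<in> E \<Longrightarrow> y \<in> F \<Longrightarrow> x + y \<le> z"
  shows "Sup E + Sup F \<le> z"
proof (cases z)
  case (enat k)
  obtain x0 y0 where "x0 \<in> E" "y0 \<in> F"
    using assms(1,2) by auto
  then have "x \<le> enat k" if "x \<in> E" for x
    using order_trans[OF _ le[OF that, of y0], of x] enat by simp
  moreover have "y \<le> enat k" if "y \<in> F" for y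
    using order_trans[OF _ le[OF _ that, of x0], of y] \<open>x0 \<in> E\<close> enat by simp
  ultimately have "finite E" "finite F"
    by (auto intro: finite_enat_bounded)
  then have "Sup E \<in> E" "Sup F \<in> F"
    using assms(1,2) by (auto simp: Sup_enat_def)
  then show ?thesis by (rule le)
qed simp

lemma (in ring) subring_of_subring_iff:
  assumes "subring A R"
  shows "subring T (R\<lparr>carrier := A\<rparr>) \<longleftrightarrow> subring T R \<and> T \<subseteq> A"
proof -
  interpret A: ring "R\<lparr>carrier := A\<rparr>"
    by (rule subring_is_ring[OF assms])
  show ?thesis
    using A.subring_iff[of T] subring_iff[of T] subringE(1)[of T "R\<lparr>carrier := A\<rparr>"]
      subringE(1)[of T R] subringE(1)[OF assms]
    by auto
qed

lemma (in ring) subalgebras_of_subring: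
  assumes "subring A R"
  shows "subalgebras K (R\<lparr>carrier := A\<rparr>) = {T \<in> subalgebras K R. T \<subseteq> A}"
  by (auto simp: subalgebras_def subring_of_subring_iff[OF assms])

lemma (in ring) compositum_props:
  assumes "T \<in> subalgebras K R" "U \<in> subalgebras K R"
  shows compositum_closed: "compositum R T U \<in> subalgebras K R"
    and compositum_upper1: "T \<subseteq> compositum R T U"
    and compositum_upper2: "U \<subseteq> compositum R T U"
    and compositum_least: "subring V R \<Longrightarrow> T \<subseteq> V \<Longrightarrow> U \<subseteq> V \<Longrightarrow> compositum R T U \<subseteq> V"
proof -
  have c: "T \<union> U \<subseteq> carrier R"
    using assms subringE(1) by (auto simp: subalgebras_def)
  note g = generate_ringE[OF c refl]
  show "compositum R T U \<in> subalgebras K R" "T \<subseteq> compositum R T U" "U \<subseteq> compositum R T U"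
    using g assms by (auto simp: subalgebras_def compositum_def)
  show "compositum R T U \<subseteq> V" if "subring V R" "T \<subseteq> V" "U \<subseteq> V"
    using g(3)[OF that(1)] that by (auto simp: compositum_def)
qed

lemma distributive_extension_mono:
  assumes "distributive_extension R S" and "R \<subseteq> A"
  shows "distributive_extension A S"
proof -
  have "subalgebras A S \<subseteq> subalgebras R S" using assms(2) by (auto simp: subalgebras_def)
  then show ?thesis using assms(1) unfolding distributive_extension_def by blast
qed

text \<open>
  A chain in \<open>[K,S]\<close> is sent by \<open>T \<mapsto> T \<inter> A\<close> and \<open>T \<mapsto> T A\<close> to weak chains in \<open>[K,A]\<close> and \<open>[A,S]\<close>. In a
  distributive lattice this pair determines \<open>T\<close>, so each strict step survives in at least one of
  the two images. The other inequality is concatenation.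
\<close>

lemma (in ring) extension_length_additive:
  assumes "subring K R" and dist: "distributive_extension K R" and A: "A \<in> subalgebras K R"
  shows "extension_length K R = extension_length K (R\<lparr>carrier := A\<rparr>) + extension_length A R"
proof (rule antisym)
  have "subring A R" "K \<subseteq> A"
    using A by (auto simp: subalgebras_def)
  note below = subalgebras_of_subring[OF \<open>subring A R\<close>, of K]
  show "extension_length K R \<le> extension_length K (R\<lparr>carrier := A\<rparr>) + extension_length A R"
  proof (rule extension_length_leI)
    fix T n
    assume T: "strict_chain (subalgebras K R) T n"
    then have mem: "T i \<in> subalgebras K R" if "i \<le> n" for i
      using that by (auto simp: strict_chain_def)
    have step: "T i \<subset> T (Suc i)" if "i < n" for i
      using T that by (auto simp: strict_chain_def)
    let ?M = "\<lambda>i. T i \<inter> A" and ?J = "\<lambda>i. compositum R (T i) A"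
    let ?P = "{i. i < n \<and> ?M i \<noteq> ?M (Suc i)}" and ?Q = "{i. i < n \<and> ?J i \<noteq> ?J (Suc i)}"
    have M: "?M i \<in> subalgebras K (R\<lparr>carrier := A\<rparr>)" if "i \<le> n" for i
      using mem[OF that] A subring_inter unfolding below by (auto simp: subalgebras_def)
    have J: "?J i \<in> subalgebras A R" if "i \<le> n" for i
      using compositum_props[OF mem[OF that] A] by (auto simp: subalgebras_def)
    have Jmono: "?J i \<subseteq> ?J (Suc i)" if "i < n" for i
      using compositum_props[OF mem A, of i] compositum_props[OF mem A, of "Suc i"] step[OF that] that
      by (auto simp: subalgebras_def)
    have "i \<in> ?P \<union> ?Q" if "i < n" for i
    proof (rule ccontr)
      assume "i \<notin> ?P \<union> ?Q"
      then have eq: "?M i = ?M (Suc i)" "?J i = ?J (Suc i)"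
        using that by auto
      have i: "T i \<in> subalgebras K R" and Si: "T (Suc i) \<in> subalgebras K R"
        using that mem by auto
      have "T (Suc i) = T (Suc i) \<inter> compositum R (T i) A"
        using eq(2) compositum_upper1[OF Si A] by auto
      also have "\<dots> = compositum R (T (Suc i) \<inter> T i) (T (Suc i) \<inter> A)"
        using dist i Si A by (auto simp: distributive_extension_def)
      also have "\<dots> = compositum R (T i) (T i \<inter> A)"
        using eq(1) step[OF that] by (auto simp: Int_absorb1)
      also have "\<dots> \<subseteq> T i"
        using compositum_least[OF i, of "T i \<inter> A" "T i"] i A subring_inter
        by (auto simp: subalgebras_def)
      finally show False
        using step[OF that] by auto
    qed
    then have "{..<n} \<subseteq> ?P \<union> ?Q" by auto
    then have "n \<le> card (?P \<union> ?Q)"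
      using card_mono[of "?P \<union> ?Q" "{..<n}"] by auto
    also have "\<dots> \<le> card ?P + card ?Q"
      by (rule card_Un_le)
    finally have "enat n \<le> enat (card ?P) + enat (card ?Q)" by simp
    also have "\<dots> \<le> extension_length K (R\<lparr>carrier := A\<rparr>) + extension_length A R"
      using M J Jmono by (intro add_mono weak_chain_length_le) (use step in blast)+
    finally show "enat n \<le> \<dots>" .
  qed
  \<comment> \<open>The last term of the lower chain is skipped: it need not be the first term of the upper one,
    but the term before it lies strictly below \<open>A\<close>, so no step is lost.\<close>
  have concat: "enat (p + q) \<le> extension_length K R"
    if T: "strict_chain (subalgebras K (R\<lparr>carrier := A\<rparr>)) T p"
      and U: "strict_chain (subalgebras A R) U q" for T U p q
  proof -
    let ?W = "\<lambda>i. if i < p then T i else U (i - p)"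
    have "?W i \<in> subalgebras K R" if "i \<le> p + q" for i
    proof (cases "i < p")
      case True
      then show ?thesis
        using T unfolding below by (auto simp: strict_chain_def)
    next
      case False
      then have "U (i - p) \<in> subalgebras A R"
        using U that by (auto simp: strict_chain_def)
      then show ?thesis
        using False \<open>K \<subseteq> A\<close> by (auto simp: subalgebras_def)
    qed
    moreover have "?W i \<subset> ?W (Suc i)" if "i < p + q" for i
    proof -
      consider "Suc i < p" | "Suc i = p" | "p \<le> i" by linarith
      then show ?thesis
      proof cases
        case 2
        then have "T i \<subset> T p" "T p \<subseteq> A" "A \<subseteq> U 0"
          using T U unfolding below by (auto simp: strict_chain_def subalgebras_def)
        then show ?thesis using 2 by auto
      next
        case 3
        then have "U (i - p) \<subset> U (Suc (i - p))"
          using U that by (auto simp: strict_chain_def)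
        then show ?thesis using 3 by (simp add: Suc_diff_le)
      qed (use T in \<open>auto simp: strict_chain_def\<close>)
    qed
    ultimately show ?thesis
      by (intro strict_chain_length_le[of K R ?W]) (auto simp: strict_chain_def)
  qed
  have triv: "strict_chain (subalgebras K (R\<lparr>carrier := A\<rparr>)) (\<lambda>_. A) 0"
    "strict_chain (subalgebras A R) (\<lambda>_. A) 0"
    using A \<open>subring A R\<close> unfolding below by (auto simp: strict_chain_def subalgebras_def)
  show "extension_length K (R\<lparr>carrier := A\<rparr>) + extension_length A R \<le> extension_length K R"
    unfolding extension_length_def[of K "R\<lparr>carrier := A\<rparr>"] extension_length_def[of A R]
    by (rule Sup_enat_add_le)
       (use triv concat in \<open>auto simp: strict_chain_def[symmetric]\<close>)
qed

lemma extension_length_self: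
  assumes "ring S" "subring A S"
  shows "extension_length A (S\<lparr>carrier := A\<rparr>) = 0"
proof -
  have "enat n \<le> 0" if T: "strict_chain (subalgebras A (S\<lparr>carrier := A\<rparr>)) T n" for T n
  proof (rule ccontr)
    assume "\<not> enat n \<le> 0"
    then have "n > 0" by (auto simp: enat_0_iff)
    then have "T 0 \<subset> T (Suc 0)" "A \<subseteq> T 0" "T (Suc 0) \<subseteq> A"
      using T unfolding ring.subalgebras_of_subring[OF assms, of A]
      by (auto simp: strict_chain_def subalgebras_def)
    then show False by auto
  qed
  then have "extension_length A (S\<lparr>carrier := A\<rparr>) \<le> 0"
    by (rule extension_length_leI)
  then show ?thesis by simp
qed

lemma extension_length_cover:
  assumes "ring S" "subring T S" "subring A S" "A \<subset> T"
    and cover: "\<And>C. subring C S \<Longrightarrow> A \<subset> C \<Longrightarrow> C \<subseteq> T \<Longrightarrow> C = T"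
  shows "extension_length A (S\<lparr>carrier := T\<rparr>) = 1"
proof (rule antisym)
  note sub = ring.subalgebras_of_subring[OF assms(1,2), of A]
  show "extension_length A (S\<lparr>carrier := T\<rparr>) \<le> 1"
  proof (rule extension_length_leI, rule ccontr)
    fix U n
    assume U: "strict_chain (subalgebras A (S\<lparr>carrier := T\<rparr>)) U n" and "\<not> enat n \<le> 1"
    then have "n > 1" by (auto simp: one_enat_def)
    then have "U 0 \<subset> U (Suc 0)" "U (Suc 0) \<subset> U (Suc (Suc 0))"
      "A \<subseteq> U 0" "subring (U (Suc 0)) S" "U (Suc (Suc 0)) \<subseteq> T"
      using U unfolding sub by (auto simp: strict_chain_def subalgebras_def)
    then show False
      using cover[of "U (Suc 0)"] by blast
  qed
  have "strict_chain (subalgebras A (S\<lparr>carrier := T\<rparr>)) (\<lambda>i. if i = 0 then A else T) 1"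
    using assms(2-4) unfolding sub by (auto simp: strict_chain_def subalgebras_def)
  then show "1 \<le> extension_length A (S\<lparr>carrier := T\<rparr>)"
    using strict_chain_length_le by (fastforce simp: one_enat_def)
qed

section \<open>Maximal ideals and the Jacobson radical\<close>

lemma idealE:
  assumes "ideal I R"
  shows "I \<subseteq> carrier R" and "\<zero>\<^bsub>R\<^esub> \<in> I"
    and "\<And>x y. x \<in> I \<Longrightarrow> y \<in> I \<Longrightarrow> x \<oplus>\<^bsub>R\<^esub> y \<in> I"
    and "\<And>x. x \<in> I \<Longrightarrow> \<ominus>\<^bsub>R\<^esub> x \<in> I"
    and "\<And>x y. x \<in> I \<Longrightarrow> y \<in> carrier R \<Longrightarrow> y \<otimes>\<^bsub>R\<^esub> x \<in> I"
    and "\<And>x y. x \<in> I \<Longrightarrow> y \<in> carrier R \<Longrightarrow> x \<otimes>\<^bsub>R\<^esub> y \<in> I"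
proof -
  interpret ideal I R by fact
  show "I \<subseteq> carrier R" "\<zero>\<^bsub>R\<^esub> \<in> I" by (auto simp: a_subset)
  show "\<And>x y. x \<in> I \<Longrightarrow> y \<in> I \<Longrightarrow> x \<oplus>\<^bsub>R\<^esub> y \<in> I" "\<And>x. x \<in> I \<Longrightarrow> \<ominus>\<^bsub>R\<^esub> x \<in> I"
    "\<And>x y. x \<in> I \<Longrightarrow> y \<in> carrier R \<Longrightarrow> y \<otimes>\<^bsub>R\<^esub> x \<in> I"
    "\<And>x y. x \<in> I \<Longrightarrow> y \<in> carrier R \<Longrightarrow> x \<otimes>\<^bsub>R\<^esub> y \<in> I"
    by (auto simp: I_l_closed I_r_closed)
qed

context cring
begin

lemma exists_maximalideal_above:
  assumes "ideal I R" and "\<one> \<notin> I"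
  shows "\<exists>N. maximalideal N R \<and> I \<subseteq> N"
proof -
  let ?A = "{J. ideal J R \<and> I \<subseteq> J \<and> \<one> \<notin> J}"
  have union: "\<Union>C \<in> ?A" if "C \<noteq> {}" "subset.chain ?A C" for C
  proof -
    have "subset.chain {J. ideal J R} C"
      using that(2) by (auto simp: pred_on.chain_def)
    then have "ideal (\<Union>C) R"
      using chain_Union_is_ideal[of C] that(1) by simp
    then show ?thesis
      using that by (auto simp: pred_on.chain_def)
  qed
  have "I \<in> ?A" using assms by simp
  then have "?A \<noteq> {}" by (metis empty_iff)
  then have "\<exists>N\<in>?A. \<forall>J\<in>?A. N \<subseteq> J \<longrightarrow> J = N"
    by (rule subset_Zorn_nonempty) (rule union)
  then obtain N where N: "N \<in> ?A" and max: "\<forall>J\<in>?A. N \<subseteq> J \<longrightarrow> J = N"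
    by (rule bexE)
  have "maximalideal N R"
  proof (rule maximalidealI)
    show "ideal N R" "carrier R \<noteq> N" using N by auto
    show "J = N \<or> J = carrier R" if "ideal J R" "N \<subseteq> J" for J
    proof (cases "\<one> \<in> J")
      case True
      then show ?thesis using ideal.one_imp_carrier[OF that(1)] by simp
    next
      case False
      then have "J \<in> ?A" using N that by auto
      then show ?thesis using max that(2) by blast
    qed
  qed
  then show ?thesis using N by auto
qed

lemma inverse_mod_maximalideal:
  assumes "maximalideal N R" and "x \<in> carrier R" and "x \<notin> N"
  shows "\<exists>y\<in>carrier R. \<one> \<ominus> x \<otimes> y \<in> N"
proof -
  interpret N: maximalideal N R by fact
  note NE = idealE[OF N.ideal_axioms] and PE = idealE[OF cgenideal_ideal[OF assms(2)]]
  have id: "ideal (N <+>\<^bsub>R\<^esub> PIdl x) R"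
    by (rule add_ideals[OF N.ideal_axioms cgenideal_ideal[OF assms(2)]])
  have "n \<in> N <+>\<^bsub>R\<^esub> PIdl x" if "n \<in> N" for n
  proof -
    have "n = n \<oplus> \<zero>" using that NE(1) by auto
    then show ?thesis using that PE(2) unfolding set_add_def' by blast
  qed
  moreover have "x \<in> N <+>\<^bsub>R\<^esub> PIdl x"
  proof -
    have "x = \<zero> \<oplus> x" using assms(2) by simp
    then show ?thesis using cgenideal_self[OF assms(2)] NE(2) unfolding set_add_def' by blast
  qed
  ultimately have "\<one> \<in> N <+>\<^bsub>R\<^esub> PIdl x"
    using N.I_maximal[OF id] idealE(1)[OF id] assms(3) by auto
  then obtain n y where n: "n \<in> N" and y: "y \<in> carrier R" and eq: "\<one> = n \<oplus> y \<otimes> x"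
    unfolding set_add_def' cgenideal_def by auto
  have "\<one> \<ominus> x \<otimes> y = n"
    unfolding eq using subsetD[OF NE(1) n] y assms(2) by algebra
  then show ?thesis using n y by auto
qed

lemma maximalideal_prime_mem:
  assumes "maximalideal N R" "a \<in> carrier R" "b \<in> carrier R" "a \<otimes> b \<in> N"
  shows "a \<in> N \<or> b \<in> N"
  by (rule primeideal.I_prime[OF maximalideal_prime[OF assms(1)] assms(2-4)])

lemma maximalideal_one_notin:
  assumes "maximalideal N R"
  shows "\<one> \<notin> N"
proof -
  interpret N: maximalideal N R by fact
  show ?thesis using N.one_imp_carrier N.I_notcarr by blast
qed

lemma maximalideal_pow_mem:
  assumes "maximalideal N R" "a \<in> carrier R" "a [^] (n::nat) \<in> N"
  shows "a \<in> N"
  using assms(3)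
proof (induction n)
  case 0
  then show ?case using maximalideal_one_notin[OF assms(1)] by simp
next
  case (Suc n)
  then have "a [^] n \<in> N \<or> a \<in> N"
    by (intro maximalideal_prime_mem[OF assms(1)]) (simp_all add: assms(2))
  then show ?case using Suc.IH by blast
qed

lemma invertible_if_in_no_maximalideal:
  assumes "x \<in> carrier R" and "\<And>N. maximalideal N R \<Longrightarrow> x \<notin> N"
  shows "\<exists>y\<in>carrier R. x \<otimes> y = \<one>"
proof -
  have "\<one> \<in> PIdl x"
    using exists_maximalideal_above[OF cgenideal_ideal[OF assms(1)]] cgenideal_self[OF assms(1)] assms(2)
    by blast
  then obtain y where y: "y \<in> carrier R" "\<one> = y \<otimes> x"
    unfolding cgenideal_def by blast
  show ?thesis
    using y(1) trans[OF m_comm[OF assms(1) y(1)] y(2)[symmetric]] by blast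
qed

lemma pow_mem_coset_one:
  assumes "ideal I R" "a \<in> carrier R" "\<one> \<ominus> a \<in> I"
  shows "\<one> \<ominus> a [^] (n::nat) \<in> I"
proof (induction n)
  case 0
  then show ?case using idealE(2)[OF assms(1)] by (simp add: minus_eq r_neg)
next
  case (Suc n)
  have eq: "\<one> \<ominus> a [^] Suc n = (\<one> \<ominus> a [^] n) \<oplus> a [^] n \<otimes> (\<one> \<ominus> a)"
    using assms(2) nat_pow_closed[OF assms(2), of n] unfolding nat_pow_Suc by algebra
  show ?case
    unfolding eq by (intro idealE(3,5)[OF assms(1)] Suc assms nat_pow_closed)
qed

end

definition jacobson_radical :: "('a, 'b) ring_scheme \<Rightarrow> 'a set" where
  "jacobson_radical A = \<Inter>(Max_spec A)"

section \<open>Adjoining a multiplicatively closed module to a subring\<close>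

lemma set_add_memI: "a \<in> A \<Longrightarrow> b \<in> B \<Longrightarrow> a \<oplus>\<^bsub>S\<^esub> b \<in> A <+>\<^bsub>S\<^esub> B"
  by (auto simp: set_add_def')

lemma set_add_memE:
  assumes "z \<in> A <+>\<^bsub>S\<^esub> B"
  obtains a b where "a \<in> A" "b \<in> B" "z = a \<oplus>\<^bsub>S\<^esub> b"
  using assms by (auto simp: set_add_def')

lemma set_add_mono: "B \<subseteq> B' \<Longrightarrow> A <+>\<^bsub>S\<^esub> B \<subseteq> A <+>\<^bsub>S\<^esub> B'"
  by (auto simp: set_add_def')

definition nonunital_subalgebra :: "'a set \<Rightarrow> 'a set \<Rightarrow> ('a, 'b) ring_scheme \<Rightarrow> bool" where
  "nonunital_subalgebra K R S \<longleftrightarrow> K \<subseteq> carrier S \<and> \<zero>\<^bsub>S\<^esub> \<in> K \<and>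
     (\<forall>x\<in>K. \<forall>y\<in>K. x \<oplus>\<^bsub>S\<^esub> y \<in> K \<and> x \<otimes>\<^bsub>S\<^esub> y \<in> K) \<and> (\<forall>r\<in>R. \<forall>x\<in>K. r \<otimes>\<^bsub>S\<^esub> x \<in> K)"

text \<open>
  All auxiliary subalgebras below have the form \<open>K + M\<close>: with \<open>M\<close> an ideal, with \<open>M = m\<^sup>i R[b]\<close>, or with
  \<open>M = R e + J\<close> for \<open>e\<close> idempotent modulo \<open>J\<close>.
\<close>

lemma (in cring) subring_plus:
  assumes "subring K R" and "nonunital_subalgebra M K R"
  shows "K <+>\<^bsub>R\<^esub> M \<in> subalgebras K R"
proof -
  note KE = subringE[OF assms(1)]
  have M: "M \<subseteq> carrier R" "\<zero> \<in> M" "\<And>x y. x \<in> M \<Longrightarrow> y \<in> M \<Longrightarrow> x \<oplus> y \<in> M"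
    "\<And>x y. x \<in> M \<Longrightarrow> y \<in> M \<Longrightarrow> x \<otimes> y \<in> M" "\<And>r x. r \<in> K \<Longrightarrow> x \<in> M \<Longrightarrow> r \<otimes> x \<in> M"
    using assms(2) by (auto simp: nonunital_subalgebra_def)
  have neg: "\<ominus> x \<in> M" if "x \<in> M" for x
  proof -
    have eq: "\<ominus> x = (\<ominus> \<one>) \<otimes> x" using that M(1) by (auto simp: l_minus)
    show ?thesis unfolding eq by (rule M(5)[OF KE(5)[OF KE(3)] that])
  qed
  have I: "r \<oplus> x \<in> K <+>\<^bsub>R\<^esub> M" if "r \<in> K" "x \<in> M" for r x
    using that by (auto simp: set_add_def')
  have "subring (K <+>\<^bsub>R\<^esub> M) R"
  proof (rule subringI)
    show "K <+>\<^bsub>R\<^esub> M \<subseteq> carrier R"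
      using KE(1) M(1) by (auto simp: set_add_def')
    show "\<one> \<in> K <+>\<^bsub>R\<^esub> M"
      using I[OF KE(3) M(2)] by simp
  next
    fix h assume "h \<in> K <+>\<^bsub>R\<^esub> M"
    then obtain r x where h: "h = r \<oplus> x" "r \<in> K" "x \<in> M" by (auto simp: set_add_def')
    then have "r \<in> carrier R" "x \<in> carrier R" using KE(1) M(1) by auto
    then have eq: "\<ominus> h = \<ominus> r \<oplus> \<ominus> x" unfolding h(1) by algebra
    show "\<ominus> h \<in> K <+>\<^bsub>R\<^esub> M" unfolding eq by (intro I neg KE(5) h)
  next
    fix h h' assume "h \<in> K <+>\<^bsub>R\<^esub> M" "h' \<in> K <+>\<^bsub>R\<^esub> M"
    then obtain r x r' x' where h: "h = r \<oplus> x" "r \<in> K" "x \<in> M"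
      and h': "h' = r' \<oplus> x'" "r' \<in> K" "x' \<in> M"
      by (auto simp: set_add_def')
    note c = subsetD[OF KE(1) h(2)] subsetD[OF KE(1) h'(2)] subsetD[OF M(1) h(3)] subsetD[OF M(1) h'(3)]
    have eq: "h \<oplus> h' = (r \<oplus> r') \<oplus> (x \<oplus> x')"
      using c unfolding h(1) h'(1) by algebra
    show "h \<oplus> h' \<in> K <+>\<^bsub>R\<^esub> M"
      unfolding eq by (intro I M(3) KE(7) h h')
    have eq: "h \<otimes> h' = (r \<otimes> r') \<oplus> ((r \<otimes> x' \<oplus> r' \<otimes> x) \<oplus> x \<otimes> x')"
      using c unfolding h(1) h'(1) by algebra
    show "h \<otimes> h' \<in> K <+>\<^bsub>R\<^esub> M"
      unfolding eq by (intro I M(3-5) KE(6) h h')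
  qed
  moreover have "K \<subseteq> K <+>\<^bsub>R\<^esub> M"
  proof
    fix r assume "r \<in> K"
    then show "r \<in> K <+>\<^bsub>R\<^esub> M" using I[OF _ M(2), of r] KE(1) by auto
  qed
  ultimately show ?thesis by (auto simp: subalgebras_def)
qed

lemma nonunital_subalgebra_of_ideal:
  assumes "ideal I S" "R \<subseteq> carrier S"
  shows "nonunital_subalgebra I R S"
  unfolding nonunital_subalgebra_def
  by (intro conjI ballI idealE(1-3,5)[OF assms(1)])
     (use idealE(1)[OF assms(1)] assms(2) in auto)

locale local_integral_FCP_extension = cring S for S (structure) +
  fixes R
  assumes R_subring: "subring R S"
    and R_integral: "integral_extension R S"
    and R_FCP: "FCP_extension R S"
    and R_local: "local_ring (S\<lparr>carrier := R\<rparr>)"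
begin

abbreviation J where "J \<equiv> jacobson_radical S"

lemmas RE = subringE[OF R_subring]

lemma R_carr: "r \<in> R \<Longrightarrow> r \<in> carrier S"
  using RE(1) by auto

lemma integral_relation:
  assumes "b \<in> carrier S"
  obtains q where "set q \<subseteq> R" "b [^] length q \<oplus> eval q b = \<zero>"
proof -
  obtain p where p: "p \<in> carrier (R[X]\<^bsub>S\<^esub>)" "p \<noteq> []" "lead_coeff p = \<one>" "eval p b = \<zero>"
    using R_integral assms unfolding integral_extension_def by blast
  then obtain q where q: "p = \<one> # q" by (cases p) auto
  have "polynomial\<^bsub>S\<^esub> R p" using p(1) univ_poly_carrier by blast
  then have "set q \<subseteq> R" using q by (auto simp: polynomial_def)
  moreover have "b [^] length q \<oplus> eval q b = \<zero>"
    using p(4) assms unfolding q by simp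
  ultimately show thesis by (rule that)
qed

lemma eval_R_carr:
  "set q \<subseteq> R \<Longrightarrow> b \<in> carrier S \<Longrightarrow> eval q b \<in> carrier S"
  using RE(1) by (intro eval_in_carrier) auto

text \<open>
  Multiply an integral equation \<open>s\<^sup>n + a\<^sub>1 s\<^sup>n\<^sup>-\<^sup>1 + \<dots> + a\<^sub>n = 0\<close> by \<open>r\<^sup>n\<close>: modulo \<open>I\<close> the first term becomes \<open>1\<close>
  and the others become multiples of \<open>r\<close> with coefficients in \<open>R\<close>. With \<open>I\<close> a maximal ideal
  this says that maximal ideals contract to maximal ideals; with \<open>I = 0\<close>, that units of \<open>S\<close> lying in
  \<open>R\<close> are units of \<open>R\<close>.
\<close>

lemma inverse_mod_in_R:
  assumes I: "ideal I S" and r: "r \<in> R" and s: "s \<in> carrier S" and rs: "\<one> \<ominus> r \<otimes> s \<in> I"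
  shows "\<exists>t\<in>R. \<one> \<ominus> r \<otimes> t \<in> I"
proof -
  note IE = idealE[OF I]
  have rc: "r \<in> carrier S" using r R_carr by auto
  have pow: "\<one> \<ominus> r [^] n \<otimes> s [^] n \<in> I" for n :: nat
    using pow_mem_coset_one[OF I _ rs, of n] nat_pow_distrib[OF rc s, of n] rc s by simp
  have eval: "\<exists>t\<in>R. r [^] length q \<otimes> eval q s \<ominus> r \<otimes> t \<in> I" if "set q \<subseteq> R" for q
    using that
  proof (induction q)
    case Nil
    have "r [^] length [] \<otimes> eval [] s \<ominus> r \<otimes> \<zero> = \<zero>" using rc by (simp add: minus_eq)
    then show ?case using RE(2) IE(2) by metis
  next
    case (Cons a q)
    define n where "n = length q"
    obtain t where t: "t \<in> R" "r [^] n \<otimes> eval q s \<ominus> r \<otimes> t \<in> I"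
      using Cons unfolding n_def by auto
    have a: "a \<in> R" "a \<in> carrier S" using Cons.prems R_carr by auto
    define e v w where "e = eval q s" and "v = r [^] n" and "w = s [^] n"
    have c: "e \<in> carrier S" "v \<in> carrier S" "w \<in> carrier S" "t \<in> carrier S"
      unfolding e_def v_def w_def
      using Cons.prems s rc t(1) R_carr by (auto intro: eval_R_carr)
    have "eval (a # q) s = a \<otimes> w \<oplus> e"
      by (simp add: e_def w_def n_def)
    then have "r [^] length (a # q) \<otimes> eval (a # q) s \<ominus> r \<otimes> (a \<oplus> r \<otimes> t)
        = v \<otimes> r \<otimes> (a \<otimes> w \<oplus> e) \<ominus> r \<otimes> (a \<oplus> r \<otimes> t)"
      by (simp add: v_def n_def)
    also have "\<dots> = r \<otimes> (v \<otimes> e \<ominus> r \<otimes> t) \<oplus> (\<ominus> (r \<otimes> a)) \<otimes> (\<one> \<ominus> v \<otimes> w)"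
      using c rc a by algebra
    also have "\<dots> \<in> I"
      using t(2) pow[of n] rc a(2) unfolding e_def[symmetric] v_def[symmetric] w_def[symmetric]
      by (intro IE) auto
    finally show ?case
      using RE(6,7) a(1) r t(1) by blast
  qed
  obtain q where q: "set q \<subseteq> R" "s [^] length q \<oplus> eval q s = \<zero>"
    using integral_relation[OF s] .
  obtain t where t: "t \<in> R" "r [^] length q \<otimes> eval q s \<ominus> r \<otimes> t \<in> I"
    using eval[OF q(1)] by blast
  define e v w where "e = eval q s" and "v = r [^] length q" and "w = s [^] length q"
  have c: "e \<in> carrier S" "v \<in> carrier S" "w \<in> carrier S" "t \<in> carrier S"
    unfolding e_def v_def w_def
    using q(1) s rc t(1) R_carr by (auto intro: eval_R_carr)
  have "\<one> \<ominus> r \<otimes> (\<ominus> t) = (\<one> \<ominus> v \<otimes> w) \<oplus> (\<ominus> (v \<otimes> e \<ominus> r \<otimes> t)) \<oplus> v \<otimes> (w \<oplus> e)"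
    using c rc by algebra
  also have "\<dots> = (\<one> \<ominus> v \<otimes> w) \<oplus> (\<ominus> (v \<otimes> e \<ominus> r \<otimes> t))"
    using q(2) c rc unfolding e_def[symmetric] w_def[symmetric] by simp
  also have "\<dots> \<in> I"
    using t(2) pow[of "length q"] unfolding e_def[symmetric] v_def[symmetric] w_def[symmetric]
    by (intro IE)
  finally show ?thesis using RE(5) t(1) by blast
qed

lemma contraction_maximal:
  assumes N: "maximalideal N S"
  shows "maximalideal (N \<inter> R) (S\<lparr>carrier := R\<rparr>)"
proof (rule maximalidealI)
  interpret N: maximalideal N S by fact
  interpret R: ring "S\<lparr>carrier := R\<rparr>" by (rule subring_is_ring[OF R_subring])
  have "ring_hom_ring (S\<lparr>carrier := R\<rparr>) S (\<lambda>x. x)"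
    using RE(1) by unfold_locales (auto simp: ring_hom_def)
  then have "ideal {r \<in> carrier (S\<lparr>carrier := R\<rparr>). r \<in> N} (S\<lparr>carrier := R\<rparr>)"
    using ring_hom_ring.ideal_vimage N.ideal_axioms by fastforce
  moreover have "{r \<in> carrier (S\<lparr>carrier := R\<rparr>). r \<in> N} = N \<inter> R" by auto
  ultimately show "ideal (N \<inter> R) (S\<lparr>carrier := R\<rparr>)" by simp
  show "carrier (S\<lparr>carrier := R\<rparr>) \<noteq> N \<inter> R"
    using maximalideal_one_notin[OF N] RE(3) by auto
  fix K assume K: "ideal K (S\<lparr>carrier := R\<rparr>)" "N \<inter> R \<subseteq> K" "K \<subseteq> carrier (S\<lparr>carrier := R\<rparr>)"
  show "K = N \<inter> R \<or> K = carrier (S\<lparr>carrier := R\<rparr>)"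
  proof (cases "K \<subseteq> N")
    case True
    then show ?thesis using K by auto
  next
    case False
    then obtain x where x: "x \<in> K" "x \<notin> N" by auto
    then have xR: "x \<in> R" using K by auto
    obtain y where "y \<in> carrier S" "\<one> \<ominus> x \<otimes> y \<in> N"
      using inverse_mod_maximalideal[OF N R_carr[OF xR] x(2)] by auto
    then obtain t where t: "t \<in> R" "\<one> \<ominus> x \<otimes> t \<in> N"
      using inverse_mod_in_R[OF N.ideal_axioms xR] by auto
    have "\<one> \<ominus> x \<otimes> t \<in> R"
      using t xR RE(3,5,6,7) by (simp add: minus_eq)
    then have "\<one> \<ominus> x \<otimes> t \<in> K" using t K(2) by auto
    moreover have "x \<otimes> t \<in> K" using idealE(6)[OF K(1) x(1), of t] t(1) by simp
    ultimately have "(\<one> \<ominus> x \<otimes> t) \<oplus> x \<otimes> t \<in> K" using idealE(3)[OF K(1)] by simp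
    moreover have "(\<one> \<ominus> x \<otimes> t) \<oplus> x \<otimes> t = \<one>"
      using R_carr[OF xR] R_carr[OF t(1)] by algebra
    ultimately show ?thesis
      using ideal.one_imp_carrier[OF K(1)] by simp
  qed
qed

lemma contractions_eq:
  assumes "maximalideal N S" "maximalideal N' S"
  shows "N \<inter> R = N' \<inter> R"
  using R_local contraction_maximal[OF assms(1)] contraction_maximal[OF assms(2)]
  unfolding local_ring_def by auto

lemma one_neq_zero: "\<one> \<noteq> \<zero>"
proof
  assume "\<one> = \<zero>"
  obtain M where M: "maximalideal M (S\<lparr>carrier := R\<rparr>)"
    using R_local unfolding local_ring_def by auto
  interpret M: maximalideal M "S\<lparr>carrier := R\<rparr>" by fact
  have "\<zero> \<in> M" using idealE(2)[OF M.ideal_axioms] by simp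
  then show False
    using \<open>\<one> = \<zero>\<close> M.one_imp_carrier M.I_notcarr by auto
qed

lemma exists_maximalideal: "\<exists>N. maximalideal N S"
  using exists_maximalideal_above[OF zeroideal] one_neq_zero by auto

lemma J_ideal: "ideal J S"
proof -
  have "Max_spec S \<noteq> {}" using exists_maximalideal by (auto simp: Max_spec_def)
  moreover have "ideal N S" if "N \<in> Max_spec S" for N
    using that maximalideal.axioms(1) by (auto simp: Max_spec_def)
  ultimately show ?thesis
    unfolding jacobson_radical_def by (intro i_Intersect) auto
qed

lemmas JE = idealE[OF J_ideal]

lemma J_carr: "x \<in> J \<Longrightarrow> x \<in> carrier S"
  using JE(1) by auto

lemma J_iff: "x \<in> J \<longleftrightarrow> (\<forall>N. maximalideal N S \<longrightarrow> x \<in> N)"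
  by (auto simp: jacobson_radical_def Max_spec_def)

text \<open>
  All contractions to \<open>R\<close> agree, so one maximal ideal of \<open>S\<close> detects membership in \<open>J\<close> for elements of
  \<open>R\<close>; in particular \<open>R \<inter> J\<close> is the maximal ideal of \<open>R\<close>.
\<close>

lemma R_mem_J_iff:
  assumes "r \<in> R" "maximalideal N S"
  shows "r \<in> J \<longleftrightarrow> r \<in> N"
  using contractions_eq[OF assms(2)] assms by (auto simp: J_iff)

lemma R_unit_if_not_J:
  assumes "r \<in> R" "r \<notin> J"
  shows "\<exists>t\<in>R. r \<otimes> t = \<one>"
proof -
  have rc: "r \<in> carrier S" using assms R_carr by auto
  have "r \<notin> N" if "maximalideal N S" for N
    using R_mem_J_iff[OF assms(1) that] assms(2) by simp
  then obtain y where "y \<in> carrier S" "r \<otimes> y = \<one>"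
    using invertible_if_in_no_maximalideal[OF rc] by auto
  then have "\<one> \<ominus> r \<otimes> y \<in> {\<zero>}" by (simp add: minus_eq r_neg)
  then obtain t where t: "t \<in> R" "\<one> \<ominus> r \<otimes> t \<in> {\<zero>}"
    using inverse_mod_in_R[OF zeroideal assms(1) \<open>y \<in> carrier S\<close>] by auto
  have "\<one> = (\<one> \<ominus> r \<otimes> t) \<oplus> r \<otimes> t"
    using rc R_carr[OF t(1)] by algebra
  also have "\<dots> = r \<otimes> t"
    using t rc R_carr[OF t(1)] by simp
  finally show ?thesis using t(1) by metis
qed

lemma unit_one_minus_J:
  assumes "x \<in> J"
  shows "\<exists>y\<in>carrier S. (\<one> \<ominus> x) \<otimes> y = \<one>"
proof (rule invertible_if_in_no_maximalideal)
  have xc: "x \<in> carrier S" using assms J_carr by auto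
  then show "\<one> \<ominus> x \<in> carrier S" by simp
  fix N assume N: "maximalideal N S"
  interpret N: maximalideal N S by fact
  show "\<one> \<ominus> x \<notin> N"
  proof
    assume "\<one> \<ominus> x \<in> N"
    then have "(\<one> \<ominus> x) \<oplus> x \<in> N"
      using assms N J_iff idealE(3)[OF N.ideal_axioms] by blast
    moreover have "(\<one> \<ominus> x) \<oplus> x = \<one>" using xc by algebra
    ultimately show False using maximalideal_one_notin[OF N] by simp
  qed
qed

lemma descending_chain_stationary:
  assumes "\<And>i. f i \<in> subalgebras R S" and "\<And>i. f (Suc i) \<subseteq> f i"
  shows "\<exists>i::nat. f i = f (Suc i)"
proof (rule ccontr)
  assume "\<nexists>i. f i = f (Suc i)"
  then have strict: "f (Suc i) \<subset> f i" for i
    using assms(2)[of i] by blast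
  have less: "f j \<subset> f i" if "i < j" for i j
    using that strict by (induction j) (auto simp: less_Suc_eq)
  then have inj: "inj f"
    by (metis injI less_irrefl linorder_neqE_nat psubset_eq)
  have "f i \<subset> f j \<or> i = j \<or> f j \<subset> f i" for i j
    using less[of i j] less[of j i] by (cases rule: linorder_cases[of i j]) auto
  then have "subset.chain (subalgebras R S) (range f)"
    unfolding pred_on.chain_def using assms(1) by blast
  then have "finite (range f)"
    using R_FCP by (auto simp: FCP_extension_def)
  then show False using inj finite_imageD by blast
qed

end

section \<open>Seminormality and the maximal ideal of the base\<close>

context ring
begin

text \<open>
  If all powers from an exponent \<open>k \<ge> 2\<close> on lie in \<open>B\<close>, then so do the square and the cube of
  \<open>x\<^sup>k\<^sup>-\<^sup>1\<close>, hence \<open>x\<^sup>k\<^sup>-\<^sup>1\<close> itself.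
\<close>

lemma seminormal_pow_descent:
  assumes "seminormal B R" "x \<in> carrier R" "\<And>j. j \<ge> n \<Longrightarrow> x [^] (j::nat) \<in> B"
  shows "x \<in> B"
proof -
  have "x \<in> B" if "\<And>j. j \<ge> Suc n \<Longrightarrow> x [^] (j::nat) \<in> B" for n
    using that
  proof (induction n)
    case 0
    then show ?case using assms(2) by (metis nat_pow_eone One_nat_def order_refl)
  next
    case (Suc n)
    have "(x [^] Suc n) [^] (2::nat) \<in> B" "(x [^] Suc n) [^] (3::nat) \<in> B"
      using Suc.prems[of "Suc n * 2"] Suc.prems[of "Suc n * 3"] assms(2)
      by (simp_all only: nat_pow_pow) simp_all
    then have "x [^] Suc n \<in> B"
      using assms(1,2) unfolding seminormal_def by (meson nat_pow_closed)
    then have "x [^] j \<in> B" if "j \<ge> Suc n" for j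
      using Suc.prems[of j] that by (cases "j = Suc n") auto
    then show ?case by (rule Suc.IH)
  qed
  then show ?thesis using assms(3) by (metis Suc_leD)
qed

end

text \<open>
  The \<open>K\<close>-submodule generated by \<open>x 0, \<dots>, x (n - 1)\<close>. Splitting off the last generator is the shape
  that both the evaluation of polynomials and the elimination in \<open>nakayama\<close> need.
\<close>

fun module_span :: "'a set \<Rightarrow> ('a, 'b) ring_scheme \<Rightarrow> (nat \<Rightarrow> 'a) \<Rightarrow> nat \<Rightarrow> 'a set" where
  "module_span K R x 0 = {\<zero>\<^bsub>R\<^esub>}"
| "module_span K R x (Suc n) = {y \<oplus>\<^bsub>R\<^esub> a \<otimes>\<^bsub>R\<^esub> x n | y a. y \<in> module_span K R x n \<and> a \<in> K}"

context local_integral_FCP_extension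
begin

abbreviation span where "span \<equiv> module_span R S"

lemma span_carr:
  assumes "\<And>j. j < n \<Longrightarrow> x j \<in> carrier S"
  shows "span x n \<subseteq> carrier S"
  using assms
proof (induction n)
  case (Suc n)
  have "span x n \<subseteq> carrier S" "x n \<in> carrier S" using Suc by auto
  then show ?case using R_carr by auto
qed simp

lemma span_zero:
  assumes "\<And>j. j < n \<Longrightarrow> x j \<in> carrier S"
  shows "\<zero> \<in> span x n"
  using assms
proof (induction n)
  case (Suc n)
  then have "\<zero> \<in> span x n" "\<zero> = \<zero> \<oplus> \<zero> \<otimes> x n" by auto
  then show ?case using RE(2) by auto
qed simp

lemma span_add:
  assumes "\<And>j. j < n \<Longrightarrow> x j \<in> carrier S" "y \<in> span x n" "z \<in> span x n"
  shows "y \<oplus> z \<in> span x n"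
  using assms
proof (induction n arbitrary: y z)
  case (Suc n)
  obtain y' a where y: "y = y' \<oplus> a \<otimes> x n" "y' \<in> span x n" "a \<in> R" using Suc.prems by auto
  obtain z' b where z: "z = z' \<oplus> b \<otimes> x n" "z' \<in> span x n" "b \<in> R" using Suc.prems by auto
  have c: "y' \<in> carrier S" "z' \<in> carrier S" "x n \<in> carrier S" "a \<in> carrier S" "b \<in> carrier S"
    using span_carr[of n x] Suc.prems y z R_carr by auto
  have "y \<oplus> z = (y' \<oplus> z') \<oplus> (a \<oplus> b) \<otimes> x n"
    unfolding y(1) z(1) using c by algebra
  moreover have "y' \<oplus> z' \<in> span x n" using Suc y z by auto
  ultimately show ?case using RE(7)[OF y(3) z(3)] by auto
qed simp

lemma span_smult:
  assumes "\<And>j. j < n \<Longrightarrow> x j \<in> carrier S" "y \<in> span x n" "r \<in> R"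
  shows "r \<otimes> y \<in> span x n"
  using assms
proof (induction n arbitrary: y)
  case 0
  then show ?case using R_carr by simp
next
  case (Suc n)
  obtain y' a where y: "y = y' \<oplus> a \<otimes> x n" "y' \<in> span x n" "a \<in> R" using Suc.prems by auto
  have c: "y' \<in> carrier S" "x n \<in> carrier S" "a \<in> carrier S" "r \<in> carrier S"
    using span_carr[of n x] Suc.prems y R_carr by auto
  have "r \<otimes> y = r \<otimes> y' \<oplus> (r \<otimes> a) \<otimes> x n"
    unfolding y(1) using c by algebra
  moreover have "r \<otimes> y' \<in> span x n" using Suc y by auto
  ultimately show ?case using RE(6)[OF Suc.prems(3) y(3)] by auto
qed

lemma span_generator:
  assumes "\<And>j. j < n \<Longrightarrow> x j \<in> carrier S" "j < n"
  shows "x j \<in> span x n"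
  using assms
proof (induction n)
  case (Suc n)
  have xn: "x n \<in> carrier S" using Suc.prems by simp
  show ?case
  proof (cases "j = n")
    case True
    have "x n = \<zero> \<oplus> \<one> \<otimes> x n" using xn by simp
    moreover have "\<zero> \<in> span x n" using Suc.prems by (intro span_zero) simp
    ultimately show ?thesis using RE(3) True by auto
  next
    case False
    then have j: "x j \<in> span x n" using Suc by auto
    then have "x j = x j \<oplus> \<zero> \<otimes> x n" using xn Suc.prems by simp
    then show ?thesis using j RE(2) by auto
  qed
qed simp

lemma span_least:
  assumes "\<zero> \<in> M" and "\<And>y z. y \<in> M \<Longrightarrow> z \<in> M \<Longrightarrow> y \<oplus> z \<in> M"
    and "\<And>r j. r \<in> R \<Longrightarrow> j < n \<Longrightarrow> r \<otimes> x j \<in> M"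
  shows "span x n \<subseteq> M"
  using assms(3)
proof (induction n)
  case (Suc n)
  then have "span x n \<subseteq> M" by auto
  then show ?case using Suc.prems assms(2) by auto
qed (use assms(1) in simp)

lemma mult_span:
  assumes "\<And>j. j < n \<Longrightarrow> x j \<in> carrier S" "c \<in> carrier S" "y \<in> span x n"
  shows "c \<otimes> y \<in> span (\<lambda>j. c \<otimes> x j) n"
  using assms
proof (induction n arbitrary: y)
  case (Suc n)
  obtain y' a where y: "y = y' \<oplus> a \<otimes> x n" "y' \<in> span x n" "a \<in> R" using Suc.prems by auto
  have k: "y' \<in> carrier S" "x n \<in> carrier S" "a \<in> carrier S"
    using span_carr[of n x] Suc.prems y R_carr by auto
  have "c \<otimes> y = c \<otimes> y' \<oplus> a \<otimes> (c \<otimes> x n)"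
    unfolding y(1) using k Suc.prems(2) by algebra
  moreover have "c \<otimes> y' \<in> span (\<lambda>j. c \<otimes> x j) n" using Suc y by auto
  ultimately show ?case using y(3) by auto
qed simp

text \<open>
  Nakayama's lemma for the module \<open>(R + \<Sum> R x\<^sub>j) / R\<close>. It is proved by elimination: the relation for the
  last generator can be solved for it because \<open>1 - m a\<close> is a unit of \<open>R\<close>, and substituting the solution
  into the other relations leaves fewer generators.
\<close>

lemma nakayama:
  assumes m: "m \<in> R" "m \<in> J" and x: "\<And>j. j < n \<Longrightarrow> x j \<in> carrier S"
    and gen: "\<And>j. j < n \<Longrightarrow> \<exists>r\<in>R. \<exists>y\<in>span x n. x j = r \<oplus> m \<otimes> y"
  shows "\<forall>j<n. x j \<in> R"
  using x gen
proof (induction n)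
  case (Suc n)
  have xc: "x j \<in> carrier S" if "j < n" for j using Suc.prems(1) that by simp
  have xn: "x n \<in> carrier S" using Suc.prems(1) by simp
  have mc: "m \<in> carrier S" using m R_carr by simp
  obtain r y a where r: "r \<in> R" and y: "y \<in> span x n" and a: "a \<in> R"
    and eq: "x n = r \<oplus> m \<otimes> (y \<oplus> a \<otimes> x n)"
    using Suc.prems(2)[of n] by auto
  have c: "r \<in> carrier S" "y \<in> carrier S" "a \<in> carrier S"
    using r a subsetD[OF span_carr[of n x, OF xc] y] by (auto intro: R_carr)
  define w where "w = \<one> \<ominus> m \<otimes> a"
  have w: "w \<in> R"
    unfolding w_def using m a RE by (simp add: minus_eq)
  have "w \<notin> J"
  proof
    assume "w \<in> J"
    then have "w \<oplus> m \<otimes> a \<in> J" using JE(3) JE(6)[OF m(2) c(3)] by simp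
    moreover have "w \<oplus> m \<otimes> a = \<one>" unfolding w_def using mc c by algebra
    ultimately show False
      using exists_maximalideal maximalideal_one_notin J_iff by auto
  qed
  then obtain u where u: "u \<in> R" "w \<otimes> u = \<one>" using R_unit_if_not_J[OF w] by auto
  have uc: "u \<in> carrier S" using u R_carr by simp
  have "w \<otimes> x n = x n \<ominus> m \<otimes> a \<otimes> x n"
    unfolding w_def using mc c xn by algebra
  also have "\<dots> = (r \<oplus> m \<otimes> (y \<oplus> a \<otimes> x n)) \<ominus> m \<otimes> a \<otimes> x n"
    using eq by (rule arg_cong[of _ _ "\<lambda>z. z \<ominus> m \<otimes> a \<otimes> x n"])
  also have "\<dots> = r \<oplus> m \<otimes> y"
    using mc c xn by algebra
  finally have wx: "w \<otimes> x n = r \<oplus> m \<otimes> y" .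
  have "x n = (w \<otimes> u) \<otimes> x n" using u xn by simp
  also have "\<dots> = u \<otimes> (w \<otimes> x n)" using xn uc R_carr[OF w] by algebra
  also have "\<dots> = u \<otimes> r \<oplus> m \<otimes> (u \<otimes> y)" unfolding wx using uc c mc by algebra
  finally have xn_eq: "x n = u \<otimes> r \<oplus> m \<otimes> (u \<otimes> y)" .
  have ur: "u \<otimes> r \<in> R" and uy: "u \<otimes> y \<in> span x n"
    using u r RE(6) span_smult[OF xc y u(1)] by auto
  have "\<forall>j<n. x j \<in> R"
  proof (rule Suc.IH)
    fix j assume j: "j < n"
    then show "x j \<in> carrier S" by (rule xc)
    obtain r' y' a' where r': "r' \<in> R" and y': "y' \<in> span x n" and a': "a' \<in> R"
      and eq': "x j = r' \<oplus> m \<otimes> (y' \<oplus> a' \<otimes> x n)"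
      using Suc.prems(2)[of j] j by auto
    have c': "r' \<in> carrier S" "y' \<in> carrier S" "a' \<in> carrier S"
      using r' a' subsetD[OF span_carr[of n x, OF xc] y'] by (auto intro: R_carr)
    define s z where "s = u \<otimes> r" and "z = u \<otimes> y"
    have sz: "s \<in> carrier S" "z \<in> carrier S" "x n = s \<oplus> m \<otimes> z"
      using xn_eq uc c by (auto simp: s_def z_def)
    have "x j = (r' \<oplus> m \<otimes> a' \<otimes> s) \<oplus> m \<otimes> (y' \<oplus> (a' \<otimes> m) \<otimes> z)"
      unfolding eq' sz(3) using c' sz(1,2) mc by algebra
    moreover have "r' \<oplus> m \<otimes> a' \<otimes> s \<in> R"
      using r' a' ur m RE(6,7) by (simp add: s_def)
    moreover have "y' \<oplus> (a' \<otimes> m) \<otimes> z \<in> span x n"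
      using span_add[OF xc y'] span_smult[OF xc uy] a' m RE(6) by (simp add: z_def)
    ultimately show "\<exists>r\<in>R. \<exists>y\<in>span x n. x j = r \<oplus> m \<otimes> y" by blast
  qed
  moreover from this have "span x n \<subseteq> R"
    using RE(2,6,7) by (intro span_least) auto
  then have "x n \<in> R"
    using xn_eq ur uy m RE(6,7) by auto
  ultimately show ?case by (auto simp: less_Suc_eq)
qed simp

text \<open>
  As \<open>b\<close> is integral, \<open>D = R[b]\<close> is generated as a module by finitely many powers of \<open>b\<close>. The
  subalgebras \<open>R + m\<^sup>i D\<close> decrease, so \<open>m\<^sup>i D \<subseteq> R + m (m\<^sup>i D)\<close> for some \<open>i\<close>, and Nakayama's lemma applied to
  the generators \<open>m\<^sup>i b\<^sup>j\<close> gives \<open>m\<^sup>i D \<subseteq> R\<close>.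
\<close>

lemma pow_mult_finite_algebra_mem:
  assumes m: "m \<in> R" "m \<in> J" and b: "b \<in> carrier S"
  shows "\<exists>i. \<forall>j. m [^] (i::nat) \<otimes> b [^] (j::nat) \<in> R"
proof -
  have mc: "m \<in> carrier S" using m R_carr by simp
  have mR: "m [^] (i::nat) \<in> R" for i
    by (induction i) (use RE(3,6) m in auto)
  obtain q where q: "set q \<subseteq> R" "b [^] length q \<oplus> eval q b = \<zero>"
    using integral_relation[OF b] .
  define d where "d = length q"
  define D where "D = span (\<lambda>j. b [^] j) d"
  have pc: "b [^] j \<in> carrier S" for j :: nat using b by simp
  have Dc: "D \<subseteq> carrier S" unfolding D_def by (rule span_carr) (rule pc)
  have D0: "\<zero> \<in> D" unfolding D_def by (rule span_zero) (rule pc)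
  have Dadd: "y \<oplus> z \<in> D" if "y \<in> D" "z \<in> D" for y z
    using that unfolding D_def by (intro span_add pc)
  have Dsm: "r \<otimes> y \<in> D" if "r \<in> R" "y \<in> D" for r y
    using that unfolding D_def by (intro span_smult pc)
  have Dgen: "b [^] j \<in> D" if "j < d" for j
    using that unfolding D_def by (intro span_generator[where x = "\<lambda>j. b [^] j"] pc)
  have "eval p b \<in> span (\<lambda>j. b [^] j) (length p)" if "set p \<subseteq> R" for p
    using that
  proof (induction p)
    case (Cons a p)
    have "eval (a # p) b = eval p b \<oplus> a \<otimes> b [^] length p"
      using Cons.prems R_carr b by (simp add: a_comm eval_R_carr)
    then show ?case using Cons by auto
  qed simp
  then have "eval q b \<in> D" using q(1) by (auto simp: D_def d_def)
  then have "(\<ominus> \<one>) \<otimes> eval q b \<in> D" using Dsm RE(3,5) by blast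
  moreover have "(\<ominus> \<one>) \<otimes> eval q b = b [^] d"
  proof -
    define e v where "e = eval q b" and "v = b [^] d"
    have ev: "e \<in> carrier S" "v \<in> carrier S" "v \<oplus> e = \<zero>"
      using q eval_R_carr b by (auto simp: e_def v_def d_def)
    have "v = (v \<oplus> e) \<oplus> (\<ominus> \<one>) \<otimes> e" using ev(1,2) by algebra
    then show ?thesis using ev unfolding e_def[symmetric] v_def[symmetric] by simp
  qed
  ultimately have bd: "b [^] d \<in> D" by simp
  have Db: "b \<otimes> y \<in> D" if "y \<in> D" for y
  proof -
    have "b \<otimes> y \<in> span (\<lambda>j. b \<otimes> b [^] j) d"
      using that unfolding D_def by (intro mult_span pc b)
    moreover have "span (\<lambda>j. b \<otimes> b [^] j) d \<subseteq> D"
    proof (rule span_least[OF D0 Dadd])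
      fix r j assume "r \<in> R" "j < d"
      have "b [^] Suc j \<in> D"
        using bd Dgen[of "Suc j"] \<open>j < d\<close> by (cases "Suc j = d") auto
      then show "r \<otimes> (b \<otimes> b [^] j) \<in> D"
        using Dsm[OF \<open>r \<in> R\<close>] b nat_pow_Suc2[OF b, of j] by simp
    qed
    ultimately show ?thesis by blast
  qed
  have Dpow: "b [^] (j::nat) \<otimes> y \<in> D" if "y \<in> D" for j y
  proof (induction j)
    case 0
    then show ?case using that Dc by auto
  next
    case (Suc j)
    have "b [^] Suc j \<otimes> y = b \<otimes> (b [^] j \<otimes> y)"
      using b subsetD[OF Dc that] nat_pow_Suc2[OF b, of j] by (simp add: m_assoc del: nat_pow_Suc)
    then show ?case using Db[OF Suc] by simp
  qed
  \<comment> \<open>For \<open>d = 0\<close> the integral equation reads \<open>1 = 0\<close>.\<close>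
  have one: "\<one> \<in> D"
    using bd Dgen[of 0] by (cases "d = 0") auto
  have Dall: "b [^] (j::nat) \<in> D" for j
    using Dpow[OF one, of j] b by simp
  have Dmult: "y \<otimes> z \<in> D" if "y \<in> D" "z \<in> D" for y z
  proof -
    have zc: "z \<in> carrier S" using that Dc by auto
    have "z \<otimes> y \<in> span (\<lambda>j. z \<otimes> b [^] j) d"
      using that zc unfolding D_def by (intro mult_span pc) auto
    moreover have "span (\<lambda>j. z \<otimes> b [^] j) d \<subseteq> D"
      using Dpow[OF that(2)] Dsm zc b by (intro span_least[OF D0 Dadd]) (simp_all add: m_comm[of z])
    ultimately have "z \<otimes> y \<in> D" by blast
    then show ?thesis
      using m_comm[OF subsetD[OF Dc that(1)] zc] by simp
  qed
  define F where "F i = R <+>\<^bsub>S\<^esub> ((\<otimes>) (m [^] i) ` D)" for i :: nat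
  have F: "F i \<in> subalgebras R S" for i
    unfolding F_def
  proof (rule subring_plus[OF R_subring])
    define n where "n = m [^] i"
    have n: "n \<in> R" "n \<in> carrier S" using mR R_carr by (auto simp: n_def)
    have "n \<otimes> y \<oplus> n \<otimes> z = n \<otimes> (y \<oplus> z)" "(n \<otimes> y) \<otimes> (n \<otimes> z) = n \<otimes> (n \<otimes> (y \<otimes> z))"
      "r \<otimes> (n \<otimes> y) = n \<otimes> (r \<otimes> y)"
      if "y \<in> carrier S" "z \<in> carrier S" "r \<in> carrier S" for y z r
      using that n by algebra+
    note eqs = this[OF subsetD[OF Dc] subsetD[OF Dc] R_carr]
    have "n \<otimes> y \<oplus> n \<otimes> z \<in> (\<otimes>) n ` D" "(n \<otimes> y) \<otimes> (n \<otimes> z) \<in> (\<otimes>) n ` D"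
      if "y \<in> D" "z \<in> D" for y z
      using eqs(1,2)[OF that RE(2)] Dadd Dmult Dsm n that by auto
    moreover have "r \<otimes> (n \<otimes> y) \<in> (\<otimes>) n ` D" if "r \<in> R" "y \<in> D" for r y
      using eqs(3)[OF that(2,2,1)] Dsm that by auto
    moreover have "\<zero> \<in> (\<otimes>) n ` D"
      using D0 n by (intro image_eqI[of _ _ \<zero>]) auto
    ultimately show "nonunital_subalgebra ((\<otimes>) (m [^] i) ` D) R S"
      using n Dc unfolding nonunital_subalgebra_def n_def[symmetric] by auto
  qed
  have "F (Suc i) \<subseteq> F i" for i
  proof -
    have "m [^] Suc i \<otimes> y \<in> (\<otimes>) (m [^] i) ` D" if "y \<in> D" for y
      using Dsm[OF m(1) that] mc that Dc by (auto simp: m_assoc subset_iff)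
    then show ?thesis unfolding F_def by (intro set_add_mono) auto
  qed
  then obtain i where i: "F i = F (Suc i)"
    using descending_chain_stationary[of F, OF F] by auto
  define x where "x j = m [^] i \<otimes> b [^] j" for j :: nat
  have xc: "x j \<in> carrier S" for j using mc b by (simp add: x_def)
  have Dx: "m [^] i \<otimes> y \<in> span x d" if "y \<in> D" for y
    using that mc unfolding D_def x_def by (intro mult_span pc) auto
  have "\<forall>j<d. x j \<in> R"
  proof (rule nakayama[OF m xc])
    fix j :: nat
    have "\<zero> \<oplus> m [^] i \<otimes> b [^] j \<in> F i"
      unfolding F_def by (intro set_add_memI RE(2) imageI Dall)
    moreover have "x j = \<zero> \<oplus> m [^] i \<otimes> b [^] j" using mc b by (simp add: x_def)
    ultimately have "x j \<in> F (Suc i)" using i by simp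
    then obtain r y where ry: "r \<in> R" "y \<in> D" "x j = r \<oplus> m [^] Suc i \<otimes> y"
      unfolding F_def by (elim set_add_memE imageE) metis
    moreover have "m [^] Suc i \<otimes> y = m \<otimes> (m [^] i \<otimes> y)"
      using mc subsetD[OF Dc ry(2)] nat_pow_Suc2[OF mc, of i] by (simp add: m_assoc del: nat_pow_Suc)
    ultimately show "\<exists>r\<in>R. \<exists>y\<in>span x d. x j = r \<oplus> m \<otimes> y" using Dx by auto
  qed
  then have "span x d \<subseteq> R"
    using RE(2,6,7) by (intro span_least) auto
  then show ?thesis
    using Dx[OF Dall] by blast
qed

lemma seminormal_mult_mem:
  assumes B: "B \<in> subalgebras R S" "seminormal B S" and m: "m \<in> R" "m \<in> J" and b: "b \<in> carrier S"
  shows "m \<otimes> b \<in> B"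
proof -
  have mc: "m \<in> carrier S" using m R_carr by simp
  obtain i where i: "\<And>j. m [^] (i::nat) \<otimes> b [^] (j::nat) \<in> R"
    using pow_mult_finite_algebra_mem[OF m b] by auto
  have mR: "m [^] (i::nat) \<in> R" for i
    by (induction i) (use RE(3,6) m in auto)
  have "(m \<otimes> b) [^] j \<in> B" if "j \<ge> i" for j
  proof -
    have "(m \<otimes> b) [^] j = m [^] (j - i) \<otimes> (m [^] i \<otimes> b [^] j)"
      using nat_pow_distrib[OF mc b, of j] nat_pow_mult[OF mc, of "j - i" i] that mc b
      by (simp add: m_assoc[symmetric])
    also have "\<dots> \<in> R" using RE(6)[OF mR i] .
    finally show ?thesis using B(1) by (auto simp: subalgebras_def)
  qed
  then show ?thesis
    using seminormal_pow_descent[OF B(2), of "m \<otimes> b" i] mc b by auto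
qed

text \<open>
  The chain condition for the subalgebras \<open>R + x\<^sup>i\<^sup>+\<^sup>1 S\<close>. The exponent starts at \<open>1\<close> so that the power on the
  left lies in every ideal that contains \<open>x\<close>; then \<open>a\<close> does too.
\<close>

lemma ideal_chain_stationary:
  assumes "x \<in> carrier S"
  obtains i a s where "a \<in> R" "s \<in> carrier S" "x [^] Suc i = a \<oplus> x [^] Suc (Suc i) \<otimes> s"
proof -
  define F where "F i = R <+>\<^bsub>S\<^esub> PIdl\<^bsub>S\<^esub> (x [^] Suc i)" for i :: nat
  have F: "F i \<in> subalgebras R S" for i
    unfolding F_def using assms RE(1)
    by (intro subring_plus R_subring nonunital_subalgebra_of_ideal cgenideal_ideal) auto
  have "F (Suc i) \<subseteq> F i" for i
  proof -
    have eq: "y \<otimes> x [^] Suc (Suc i) = (y \<otimes> x) \<otimes> x [^] Suc i" if "y \<in> carrier S" for y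
      using nat_pow_Suc2[OF assms, of "Suc i"] assms that by (simp add: m_assoc del: nat_pow_Suc)
    have "PIdl\<^bsub>S\<^esub> (x [^] Suc (Suc i)) \<subseteq> PIdl\<^bsub>S\<^esub> (x [^] Suc i)"
    proof
      fix z assume "z \<in> PIdl\<^bsub>S\<^esub> (x [^] Suc (Suc i))"
      then obtain y where y: "y \<in> carrier S" "z = y \<otimes> x [^] Suc (Suc i)"
        unfolding cgenideal_def by auto
      then have "z = (y \<otimes> x) \<otimes> x [^] Suc i" "y \<otimes> x \<in> carrier S" using eq assms by auto
      then show "z \<in> PIdl\<^bsub>S\<^esub> (x [^] Suc i)" unfolding cgenideal_def by blast
    qed
    then show ?thesis unfolding F_def by (intro set_add_mono) auto
  qed
  then obtain i where i: "F i = F (Suc i)"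
    using descending_chain_stationary[of F, OF F] by auto
  have "x [^] Suc i \<in> PIdl\<^bsub>S\<^esub> (x [^] Suc i)"
    using cgenideal_self[OF nat_pow_closed[OF assms]] .
  then have "\<zero> \<oplus> x [^] Suc i \<in> F i"
    unfolding F_def by (rule set_add_memI[OF RE(2)])
  moreover have "x [^] Suc i = \<zero> \<oplus> x [^] Suc i" using assms by simp
  ultimately have "x [^] Suc i \<in> F (Suc i)" using i by simp
  then obtain a z where az: "a \<in> R" "z \<in> PIdl\<^bsub>S\<^esub> (x [^] Suc (Suc i))" "x [^] Suc i = a \<oplus> z"
    unfolding F_def by (rule set_add_memE)
  then obtain s where "s \<in> carrier S" "x [^] Suc i = a \<oplus> s \<otimes> x [^] Suc (Suc i)"
    unfolding cgenideal_def by blast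
  moreover from this have "s \<otimes> x [^] Suc (Suc i) = x [^] Suc (Suc i) \<otimes> s"
    using assms by (intro m_comm) auto
  ultimately show thesis using that[OF az(1), of s i] by metis
qed

text \<open>
  For \<open>x \<in> J\<close> the stationary chain gives \<open>x\<^sup>i (1 - x s) = a\<close> with \<open>a \<in> R \<inter> J\<close>. The second factor is a unit, so
  all powers of \<open>x\<close> from \<open>x\<^sup>i\<close> on are multiples of \<open>a\<close>, and these lie in \<open>B\<close> by \<open>seminormal_mult_mem\<close>.
\<close>

lemma J_subset_seminormal:
  assumes B: "B \<in> subalgebras R S" "seminormal B S"
  shows "J \<subseteq> B"
proof
  fix x assume x: "x \<in> J"
  then have xc: "x \<in> carrier S" by (rule J_carr)
  obtain i a s where a: "a \<in> R" and s: "s \<in> carrier S"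
    and eq: "x [^] Suc i = a \<oplus> x [^] Suc (Suc i) \<otimes> s"
    using ideal_chain_stationary[OF xc] .
  define v where "v = x [^] Suc i"
  have vc: "v \<in> carrier S" and vJ: "v \<in> J" and ac: "a \<in> carrier S"
    using xc x a JE(5) R_carr by (auto simp: v_def)
  have v_eq: "v = a \<oplus> v \<otimes> x \<otimes> s" using eq by (simp add: v_def)
  have "a = (a \<oplus> v \<otimes> x \<otimes> s) \<oplus> v \<otimes> (\<ominus> (x \<otimes> s))"
    using ac vc xc s by algebra
  then have a_eq: "a = v \<oplus> v \<otimes> (\<ominus> (x \<otimes> s))" unfolding v_eq[symmetric] .
  have aJ: "a \<in> J"
    by (subst a_eq) (intro JE(3,6) vJ a_inv_closed m_closed xc s)
  have av: "a = v \<otimes> (\<one> \<ominus> x \<otimes> s)"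
    by (subst a_eq) (use vc xc s in algebra)
  obtain u where u: "u \<in> carrier S" "(\<one> \<ominus> x \<otimes> s) \<otimes> u = \<one>"
    using unit_one_minus_J[OF JE(6)[OF x s]] by auto
  have "v = v \<otimes> ((\<one> \<ominus> x \<otimes> s) \<otimes> u)" using u(2) vc by simp
  also have "\<dots> = (v \<otimes> (\<one> \<ominus> x \<otimes> s)) \<otimes> u" using vc xc s u(1) by algebra
  finally have vu: "v = a \<otimes> u" unfolding av[symmetric] .
  have "x [^] j \<in> B" if "j \<ge> Suc i" for j
  proof -
    have "x [^] j = v \<otimes> x [^] (j - Suc i)"
      using nat_pow_mult[OF xc, of "Suc i" "j - Suc i"] that by (simp add: v_def)
    also have "\<dots> = a \<otimes> (u \<otimes> x [^] (j - Suc i))"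
      unfolding vu using ac u xc by (simp add: m_assoc)
    also have "\<dots> \<in> B"
      using u xc by (intro seminormal_mult_mem[OF B a aJ]) auto
    finally show ?thesis .
  qed
  then show "x \<in> B" using seminormal_pow_descent[OF B(2) xc] by blast
qed

end

section \<open>Idempotents modulo the Jacobson radical\<close>

context local_integral_FCP_extension
begin

lemma plus_ideal_subalgebra:
  assumes "ideal I S"
  shows "R <+>\<^bsub>S\<^esub> I \<in> subalgebras R S"
  by (intro subring_plus R_subring nonunital_subalgebra_of_ideal assms RE(1))

text \<open>
  Division in the field \<open>(R + I) / I\<close>, for \<open>I = J\<close> or \<open>I\<close> a maximal ideal: the element \<open>c\<close> is a unit of \<open>R\<close>.
\<close>

lemma mem_plus_cancel_unit:
  assumes I: "ideal I S" and c: "c \<in> R" "c \<notin> J" and n: "n \<in> I" and b: "b \<in> carrier S"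
    and prod: "b \<otimes> (c \<oplus> n) \<in> R <+>\<^bsub>S\<^esub> I"
  shows "b \<in> R <+>\<^bsub>S\<^esub> I"
proof -
  obtain t where t: "t \<in> R" "c \<otimes> t = \<one>" using R_unit_if_not_J[OF c] by auto
  obtain r x where rx: "r \<in> R" "x \<in> I" "b \<otimes> (c \<oplus> n) = r \<oplus> x"
    using prod by (auto simp: set_add_def')
  have k: "c \<in> carrier S" "n \<in> carrier S" "t \<in> carrier S" "r \<in> carrier S" "x \<in> carrier S"
    using c n t rx R_carr idealE(1)[OF I] by auto
  have "b = (c \<otimes> t) \<otimes> b" using t(2) b by simp
  also have "\<dots> = t \<otimes> (b \<otimes> (c \<oplus> n)) \<oplus> (\<ominus> (t \<otimes> b)) \<otimes> n" using k b by algebra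
  also have "\<dots> = t \<otimes> r \<oplus> (t \<otimes> x \<oplus> (\<ominus> (t \<otimes> b)) \<otimes> n)" unfolding rx(3) using k b by algebra
  finally have "b = t \<otimes> r \<oplus> (t \<otimes> x \<oplus> (\<ominus> (t \<otimes> b)) \<otimes> n)" .
  moreover have "t \<otimes> r \<in> R" using t rx RE(6) by blast
  moreover have "t \<otimes> x \<oplus> (\<ominus> (t \<otimes> b)) \<otimes> n \<in> I"
    by (intro idealE(3,5)[OF I] rx n a_inv_closed m_closed k b)
  ultimately show ?thesis using set_add_memI[of _ R _ I S] by metis
qed

text \<open>
  Modulo \<open>J\<close>, either \<open>b\<^sup>2 = 0\<close> and \<open>b\<close> vanishes because \<open>S / J\<close> is reduced, or \<open>b = b\<^sup>3 / b\<^sup>2\<close> is a quotient in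
  the residue field of \<open>R\<close>.
\<close>

lemma plus_J_seminormal: "seminormal (R <+>\<^bsub>S\<^esub> J) S"
  unfolding seminormal_def
proof (intro ballI impI)
  fix b assume b: "b \<in> carrier S" and b2: "b [^] (2::nat) \<in> R <+>\<^bsub>S\<^esub> J"
    and b3: "b [^] (3::nat) \<in> R <+>\<^bsub>S\<^esub> J"
  obtain r x where rx: "r \<in> R" "x \<in> J" "b [^] (2::nat) = r \<oplus> x"
    using b2 by (auto simp: set_add_def')
  show "b \<in> R <+>\<^bsub>S\<^esub> J"
  proof (cases "r \<in> J")
    case True
    then have "b [^] (2::nat) \<in> J" using JE(3) rx by simp
    then have "b \<in> J" using maximalideal_pow_mem[OF _ b] by (auto simp: J_iff)
    moreover have "b = \<zero> \<oplus> b" using b by simp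
    ultimately show ?thesis using set_add_memI[OF RE(2)] by metis
  next
    case False
    have "b \<otimes> b [^] (2::nat) = b [^] (3::nat)"
      using nat_pow_Suc2[OF b, of 2] by (simp add: numeral_3_eq_3 numeral_2_eq_2)
    then show ?thesis
      using mem_plus_cancel_unit[OF J_ideal rx(1) False rx(2) b] b3 rx(3) by simp
  qed
qed

lemma seminormalization_eq: "seminormalization R S = R <+>\<^bsub>S\<^esub> J"
proof
  note least = seminormalization_least[OF ring_axioms R_subring]
  show "seminormalization R S \<subseteq> R <+>\<^bsub>S\<^esub> J"
    by (rule least(3)[OF plus_ideal_subalgebra[OF J_ideal] plus_J_seminormal])
  have "J \<subseteq> seminormalization R S" by (rule J_subset_seminormal[OF least(1,2)])
  then show "R <+>\<^bsub>S\<^esub> J \<subseteq> seminormalization R S"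
    using least(1) subringE(7)[of "seminormalization R S" S]
    by (auto simp: set_add_def' subalgebras_def)
qed

text \<open>
  Modulo \<open>N\<close> put \<open>k = b\<^sup>2 - r b\<close>. If \<open>k = 0\<close> then \<open>b = 0\<close> or \<open>b = r\<close> in the field \<open>S / N\<close>; otherwise
  \<open>b = (b\<^sup>3 - r b\<^sup>2) / k\<close>.
\<close>

lemma plus_maximalideal_t_closed:
  assumes N: "maximalideal N S"
  shows "t_closed (R <+>\<^bsub>S\<^esub> N) S"
  unfolding t_closed_def
proof (intro ballI impI)
  interpret N: maximalideal N S by fact
  have id: "ideal N S" by (rule N.ideal_axioms)
  have sub: "subring (R <+>\<^bsub>S\<^esub> N) S"
    using plus_ideal_subalgebra[OF id] by (simp add: subalgebras_def)
  have NB: "x \<in> R <+>\<^bsub>S\<^esub> N" if "x \<in> N" for x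
  proof -
    have "x = \<zero> \<oplus> x" using that idealE(1)[OF id] by auto
    then show ?thesis using set_add_memI[OF RE(2) that] by metis
  qed
  fix b r
  assume b: "b \<in> carrier S" and r: "r \<in> R <+>\<^bsub>S\<^esub> N"
    and k: "b [^] (2::nat) \<ominus> r \<otimes> b \<in> R <+>\<^bsub>S\<^esub> N"
    and l: "b [^] (3::nat) \<ominus> r \<otimes> b [^] (2::nat) \<in> R <+>\<^bsub>S\<^esub> N"
  have rc: "r \<in> carrier S" using r subringE(1)[OF sub] by auto
  have p2: "b [^] (2::nat) = b \<otimes> b" and p3: "b [^] (3::nat) = b \<otimes> b \<otimes> b"
    using b by (simp_all add: numeral_3_eq_3 numeral_2_eq_2)
  obtain c n where cn: "c \<in> R" "n \<in> N" "b \<otimes> b \<ominus> r \<otimes> b = c \<oplus> n"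
    using k unfolding p2 by (auto simp: set_add_def')
  show "b \<in> R <+>\<^bsub>S\<^esub> N"
  proof (cases "c \<in> J")
    case True
    then have "c \<oplus> n \<in> N" using cn R_mem_J_iff[OF _ N] idealE(3)[OF id] by simp
    moreover have "b \<otimes> (b \<ominus> r) = b \<otimes> b \<ominus> r \<otimes> b" using b rc by algebra
    ultimately have "b \<otimes> (b \<ominus> r) \<in> N" using cn(3) by simp
    then have "b \<in> N \<or> b \<ominus> r \<in> N"
      by (intro maximalideal_prime_mem[OF N]) (use b rc in auto)
    then show ?thesis
    proof
      assume "b \<ominus> r \<in> N"
      then have "(b \<ominus> r) \<oplus> r \<in> R <+>\<^bsub>S\<^esub> N" using NB r subringE(7)[OF sub] by blast
      moreover have "(b \<ominus> r) \<oplus> r = b" using b rc by algebra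
      ultimately show ?thesis by simp
    qed (rule NB)
  next
    case False
    have "b \<otimes> (b \<otimes> b \<ominus> r \<otimes> b) = b \<otimes> b \<otimes> b \<ominus> r \<otimes> (b \<otimes> b)" using b rc by algebra
    then show ?thesis
      using mem_plus_cancel_unit[OF id cn(1) False cn(2) b] l unfolding p2 p3 cn(3) by simp
  qed
qed

text \<open>
  The element \<open>e\<close> represents an idempotent of \<open>S / J\<close> with value \<open>0\<close> at \<open>N\<close> and \<open>1\<close> at \<open>N'\<close>.
\<close>

definition separates :: "'a \<Rightarrow> 'a set \<Rightarrow> 'a set \<Rightarrow> bool" where
  "separates e N N' \<longleftrightarrow> e \<in> carrier S \<and> e \<in> N \<and> \<one> \<ominus> e \<in> N' \<and> e \<otimes> (\<one> \<ominus> e) \<in> J"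

text \<open>
  Take \<open>x\<close> in \<open>N\<close> but not in \<open>N'\<close>. In the stationary relation \<open>x\<^sup>i = a + x\<^sup>i\<^sup>+\<^sup>1 s\<close> the element \<open>a\<close> of \<open>R\<close> lies
  in \<open>N\<close>, hence in \<open>J\<close>. So \<open>x\<^sup>i = x\<^sup>i (x s)\<^sup>k\<close> modulo \<open>J\<close> for every \<open>k\<close>, and \<open>e = (x s)\<^sup>i\<close> is idempotent modulo
  \<open>J\<close>. It lies in \<open>N\<close> with \<open>x\<close>, and not in \<open>N'\<close> because \<open>x\<^sup>i = x\<^sup>i e\<close> modulo \<open>J\<close>.
\<close>

lemma exists_separating_idempotent:
  assumes N: "maximalideal N S" "maximalideal N' S" "N \<noteq> N'"
  shows "\<exists>e. separates e N N'"
proof -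
  interpret N: maximalideal N S by fact
  interpret N': maximalideal N' S by fact
  note NE = idealE[OF N.ideal_axioms]
  have "\<not> N \<subseteq> N'"
    using N.I_maximal[OF N'.ideal_axioms] N'.I_notcarr N(3) idealE(1)[OF N'.ideal_axioms] by auto
  then obtain x where x: "x \<in> N" "x \<notin> N'" by auto
  have xc: "x \<in> carrier S" using x NE(1) by auto
  obtain i a s where a: "a \<in> R" and s: "s \<in> carrier S"
    and eq: "x [^] Suc i = a \<oplus> x [^] Suc (Suc i) \<otimes> s"
    using ideal_chain_stationary[OF xc] .
  define v where "v = x [^] Suc i"
  define y where "y = x \<otimes> s"
  define e where "e = y [^] Suc i"
  have c: "v \<in> carrier S" "a \<in> carrier S" "y \<in> carrier S" "e \<in> carrier S"
    using xc s a R_carr by (auto simp: v_def y_def e_def)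
  have vN: "v \<in> N" using NE(5)[OF x(1), of "x [^] i"] xc by (simp add: v_def)
  have "x [^] Suc (Suc i) \<otimes> s = v \<otimes> y"
    unfolding v_def y_def using xc s by (simp add: m_assoc)
  then have v_eq: "v = a \<oplus> v \<otimes> y" using eq unfolding v_def by (rule subst)
  have "v \<otimes> (\<one> \<ominus> y) = v \<ominus> v \<otimes> y" using c by algebra
  also have "\<dots> = (a \<oplus> v \<otimes> y) \<ominus> v \<otimes> y"
    using v_eq by (rule arg_cong[of _ _ "\<lambda>z. z \<ominus> v \<otimes> y"])
  also have "\<dots> = a" using c by algebra
  finally have va: "v \<otimes> (\<one> \<ominus> y) = a" .
  then have "a \<in> N" using NE(6)[OF vN, of "\<one> \<ominus> y"] c by simp
  then have "a \<in> J" using R_mem_J_iff[OF a N(1)] by simp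
  then have vy: "v \<otimes> (\<one> \<ominus> y) \<in> J" using va by simp
  have "v \<otimes> (\<one> \<ominus> y [^] k) \<in> J" for k :: nat
  proof (induction k)
    case 0
    have "v \<otimes> (\<one> \<ominus> y [^] (0::nat)) = \<zero>" using c by (simp add: minus_eq r_neg)
    then show ?case using JE(2) by simp
  next
    case (Suc k)
    define w where "w = y [^] k"
    have w: "w \<in> carrier S" using c by (simp add: w_def)
    have "v \<otimes> (\<one> \<ominus> w \<otimes> y) = v \<otimes> (\<one> \<ominus> w) \<oplus> w \<otimes> (v \<otimes> (\<one> \<ominus> y))"
      using c w by algebra
    also have "\<dots> \<in> J"
      using JE(3)[OF Suc[folded w_def] JE(5)[OF vy w]] .
    finally show ?case by (simp add: w_def)
  qed
  then have ve: "v \<otimes> (\<one> \<ominus> e) \<in> J" unfolding e_def .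
  have e_eq: "e = v \<otimes> s [^] Suc i"
    unfolding e_def y_def v_def using nat_pow_distrib[OF xc s, of "Suc i"] .
  define w where "w = s [^] Suc i"
  have w: "w \<in> carrier S" "e = v \<otimes> w" using s e_eq by (auto simp: w_def)
  have "e \<otimes> (\<one> \<ominus> e) = w \<otimes> (v \<otimes> (\<one> \<ominus> e))"
    using c w m_comm[of v w] by (simp add: m_assoc)
  then have ee: "e \<otimes> (\<one> \<ominus> e) \<in> J" using JE(5)[OF ve w(1)] by simp
  have eN: "e \<in> N" using NE(6)[OF vN w(1)] w by simp
  have "e \<notin> N'"
  proof
    assume eN': "e \<in> N'"
    have "v = v \<otimes> (\<one> \<ominus> e) \<oplus> v \<otimes> e" using c by algebra
    moreover have "v \<otimes> (\<one> \<ominus> e) \<oplus> v \<otimes> e \<in> N'"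
    proof -
      have "v \<otimes> (\<one> \<ominus> e) \<in> N'" using ve N(2) unfolding J_iff by blast
      then show ?thesis
        by (rule idealE(3)[OF N'.ideal_axioms]) (rule idealE(5)[OF N'.ideal_axioms eN' c(1)])
    qed
    ultimately have "v \<in> N'" by simp
    then show False using maximalideal_pow_mem[OF N(2) xc] x(2) unfolding v_def by blast
  qed
  moreover have "e \<otimes> (\<one> \<ominus> e) \<in> N'" using ee J_iff N(2) by auto
  ultimately have "\<one> \<ominus> e \<in> N'"
    using maximalideal_prime_mem[OF N(2), of e "\<one> \<ominus> e"] c by auto
  then show ?thesis unfolding separates_def using c(4) eN ee by blast
qed

text \<open>
  For \<open>e\<close> idempotent modulo \<open>J\<close> this is the subalgebra generated by \<open>e\<close> over \<open>R + J\<close>.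
\<close>

definition adjoin :: "'a \<Rightarrow> 'a set" where
  "adjoin e = R <+>\<^bsub>S\<^esub> {b \<otimes> e \<oplus> x | b x. b \<in> R \<and> x \<in> J}"

lemma mem_adjoinE:
  assumes "z \<in> adjoin e"
  obtains a b x where "a \<in> R" "b \<in> R" "x \<in> J" "z = a \<oplus> (b \<otimes> e \<oplus> x)"
  using assms unfolding adjoin_def by (elim set_add_memE) blast

lemma mem_adjoinI:
  "a \<in> R \<Longrightarrow> b \<in> R \<Longrightarrow> x \<in> J \<Longrightarrow> a \<oplus> (b \<otimes> e \<oplus> x) \<in> adjoin e"
  unfolding adjoin_def by (rule set_add_memI) auto

lemma self_mem_adjoin:
  assumes "e \<in> carrier S"
  shows "e \<in> adjoin e"
  using mem_adjoinI[OF RE(2,3) JE(2), of e] assms by simp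

lemma adjoin_subalgebra:
  assumes e: "e \<in> carrier S" and idem: "e \<otimes> (\<one> \<ominus> e) \<in> J"
  shows "adjoin e \<in> subalgebras R S"
  unfolding adjoin_def
proof (intro subring_plus R_subring, unfold nonunital_subalgebra_def, intro conjI ballI)
  let ?M = "{b \<otimes> e \<oplus> x | b x. b \<in> R \<and> x \<in> J}"
  show "?M \<subseteq> carrier S" using e R_carr J_carr by auto
  have "\<zero> = \<zero> \<otimes> e \<oplus> \<zero>" using e by simp
  then show "\<zero> \<in> ?M" using RE(2) JE(2) by blast
  {
    fix y z assume "y \<in> ?M" "z \<in> ?M"
    then obtain b x b' x' where y: "y = b \<otimes> e \<oplus> x" "b \<in> R" "x \<in> J"
      and z: "z = b' \<otimes> e \<oplus> x'" "b' \<in> R" "x' \<in> J" by blast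
    have k: "b \<in> carrier S" "x \<in> carrier S" "b' \<in> carrier S" "x' \<in> carrier S"
      using y z R_carr J_carr by auto
    have "y \<oplus> z = (b \<oplus> b') \<otimes> e \<oplus> (x \<oplus> x')" unfolding y(1) z(1) using k e by algebra
    then show "y \<oplus> z \<in> ?M" using RE(7)[OF y(2) z(2)] JE(3)[OF y(3) z(3)] by blast
    define w where "w = (\<ominus> (b \<otimes> b')) \<otimes> (e \<otimes> (\<one> \<ominus> e)) \<oplus> (b \<otimes> e \<otimes> x' \<oplus> z \<otimes> x)"
    have "y \<otimes> z = (b \<otimes> b') \<otimes> e \<oplus> w"
      unfolding w_def y(1) z(1) using k e by algebra
    moreover have "w \<in> J"
      unfolding w_def using k e z(1) by (intro idem y z JE(3) JE(5)) auto
    ultimately show "y \<otimes> z \<in> ?M" using RE(6)[OF y(2) z(2)] by blast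
  }
  fix r y assume r: "r \<in> R" and "y \<in> ?M"
  then obtain b x where y: "y = b \<otimes> e \<oplus> x" "b \<in> R" "x \<in> J" by blast
  have k: "b \<in> carrier S" "x \<in> carrier S" "r \<in> carrier S"
    using y r R_carr J_carr by auto
  have "r \<otimes> y = (r \<otimes> b) \<otimes> e \<oplus> r \<otimes> x" unfolding y(1) using k e by algebra
  then show "r \<otimes> y \<in> ?M" using RE(6)[OF r y(2)] JE(5)[OF y(3) k(3)] by blast
qed

lemma adjoin_least:
  assumes C: "subring C S" "R \<subseteq> C" "J \<subseteq> C" and e: "e \<in> C"
  shows "adjoin e \<subseteq> C"
proof
  fix z assume "z \<in> adjoin e"
  then obtain a b x where "a \<in> R" "b \<in> R" "x \<in> J" "z = a \<oplus> (b \<otimes> e \<oplus> x)"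
    by (rule mem_adjoinE)
  then show "z \<in> C"
    using C(2,3) e by (auto intro!: subringE(6,7)[OF C(1)])
qed

text \<open>
  Write \<open>z = a + b e = c + d f\<close> modulo \<open>J\<close>. At \<open>N\<close> both \<open>e\<close> and \<open>f\<close> vanish, so \<open>a = c\<close>; at \<open>N'\<close> the values are
  \<open>0\<close> and \<open>1\<close>, so \<open>a = c + d\<close>. Both are equations in the residue field of \<open>R\<close>, whence \<open>d = 0\<close> there.
\<close>

lemma adjoin_inter:
  assumes e: "e \<in> carrier S" "f \<in> carrier S"
    and N: "maximalideal N S" "maximalideal N' S"
    and "e \<in> N" "f \<in> N" "e \<in> N'" "\<one> \<ominus> f \<in> N'"
  shows "adjoin e \<inter> adjoin f \<subseteq> R <+>\<^bsub>S\<^esub> J"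
proof
  fix z assume "z \<in> adjoin e \<inter> adjoin f"
  then obtain a b x c d y where z: "z = a \<oplus> (b \<otimes> e \<oplus> x)" "a \<in> R" "b \<in> R" "x \<in> J"
    and z': "z = c \<oplus> (d \<otimes> f \<oplus> y)" "c \<in> R" "d \<in> R" "y \<in> J"
    by (elim IntE mem_adjoinE)
  have k: "a \<in> carrier S" "b \<in> carrier S" "x \<in> carrier S" "c \<in> carrier S" "d \<in> carrier S"
    "y \<in> carrier S" using z z' R_carr J_carr by auto
  note NE = idealE[OF maximalideal.axioms(1)[OF N(1)]]
  note NE' = idealE[OF maximalideal.axioms(1)[OF N(2)]]
  have eq: "a \<oplus> (b \<otimes> e \<oplus> x) = c \<oplus> (d \<otimes> f \<oplus> y)" using z(1) z'(1) by simp
  have xy: "x \<in> N" "y \<in> N" "x \<in> N'" "y \<in> N'" using z z' N by (auto simp: J_iff)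
  have acR: "a \<ominus> c \<in> R" using z z' RE(5,7) by (simp add: minus_eq)
  have "a \<ominus> c = (a \<oplus> (b \<otimes> e \<oplus> x)) \<oplus> (\<ominus> c \<oplus> \<ominus> (b \<otimes> e \<oplus> x))"
    using k e by algebra
  also have "\<dots> = (d \<otimes> f \<oplus> y) \<oplus> \<ominus> (b \<otimes> e \<oplus> x)"
    unfolding eq using k e by algebra
  finally have ac: "a \<ominus> c = (d \<otimes> f \<oplus> y) \<oplus> \<ominus> (b \<otimes> e \<oplus> x)" .
  have "a \<ominus> c \<in> N"
    unfolding ac by (intro NE(3-5) assms xy k)
  then have acJ: "a \<ominus> c \<in> J" using R_mem_J_iff[OF acR N(1)] by simp
  have "d = d \<otimes> (\<one> \<ominus> f) \<oplus> (((d \<otimes> f \<oplus> y) \<oplus> \<ominus> (b \<otimes> e \<oplus> x)) \<oplus> ((b \<otimes> e \<oplus> x) \<oplus> \<ominus> y))"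
    using k e by algebra
  also have "\<dots> \<in> N'"
    unfolding ac[symmetric] using acJ N by (intro NE'(3-5) assms xy k) (auto simp: J_iff)
  finally have "d \<in> J" using R_mem_J_iff[OF z'(3) N(2)] by simp
  then have "d \<otimes> f \<oplus> y \<in> J" using JE(3,6) z'(4) e by simp
  then show "z \<in> R <+>\<^bsub>S\<^esub> J" unfolding z'(1) by (rule set_add_memI[OF z'(2)])
qed

lemma idempotent_notin_plus_J:
  assumes "separates e N N'" "maximalideal N S" "maximalideal N' S"
  shows "e \<notin> R <+>\<^bsub>S\<^esub> J"
proof
  assume "e \<in> R <+>\<^bsub>S\<^esub> J"
  then obtain r x where rx: "r \<in> R" "x \<in> J" "e = r \<oplus> x" by (auto simp: set_add_def')
  have e: "e \<in> carrier S" "e \<in> N" "\<one> \<ominus> e \<in> N'" using assms(1) by (auto simp: separates_def)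
  have k: "r \<in> carrier S" "x \<in> carrier S" using rx R_carr J_carr by auto
  note NE = idealE[OF maximalideal.axioms(1)[OF assms(2)]]
  note NE' = idealE[OF maximalideal.axioms(1)[OF assms(3)]]
  have "r = (r \<oplus> x) \<oplus> \<ominus> x" using k by algebra
  also have "\<dots> \<in> N" unfolding rx(3)[symmetric] using rx(2) assms(2)
    by (intro NE(3,4) e) (auto simp: J_iff)
  finally have "r \<in> J" using R_mem_J_iff[OF rx(1) assms(2)] by simp
  then have "e \<in> J" using rx JE(3) by simp
  then have "e \<in> N'" using assms(3) by (auto simp: J_iff)
  then have "(\<one> \<ominus> e) \<oplus> e \<in> N'" using e NE'(3) by blast
  moreover have "(\<one> \<ominus> e) \<oplus> e = \<one>" using e by algebra
  ultimately show False using maximalideal_one_notin[OF assms(3)] by simp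
qed

lemma idempotent_mult:
  assumes "e \<in> carrier S" "f \<in> carrier S" "e \<otimes> (\<one> \<ominus> e) \<in> J" "f \<otimes> (\<one> \<ominus> f) \<in> J"
  shows "(e \<otimes> f) \<otimes> (\<one> \<ominus> e \<otimes> f) \<in> J"
proof -
  have "(e \<otimes> f) \<otimes> (\<one> \<ominus> e \<otimes> f) = f \<otimes> (e \<otimes> (\<one> \<ominus> e)) \<oplus> (e \<otimes> e) \<otimes> (f \<otimes> (\<one> \<ominus> f))"
    using assms(1,2) by algebra
  also have "\<dots> \<in> J" by (intro assms JE(3,5) m_closed)
  finally show ?thesis .
qed

text \<open>
  The elements \<open>e\<close> and \<open>f\<close> below represent idempotents of \<open>S / J\<close> with values \<open>(1,0,0)\<close> and \<open>(0,0,1)\<close> at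
  \<open>(N1,N2,N3)\<close>. With \<open>U\<close>, \<open>V\<close>, \<open>W\<close> the subalgebras obtained by adjoining \<open>e\<close>, \<open>f\<close> and \<open>e + f\<close>, the compositum
  \<open>V W\<close> contains \<open>e\<close>, so \<open>U \<inter> V W\<close> does. But \<open>(U \<inter> V) (U \<inter> W) = R + J\<close> does not.
\<close>

lemma no_three_maximalideals:
  assumes dist: "distributive_extension R S"
    and N: "maximalideal N1 S" "maximalideal N2 S" "maximalideal N3 S"
  shows "N1 = N2 \<or> N1 = N3 \<or> N2 = N3"
proof (rule ccontr)
  assume "\<not> ?thesis"
  then obtain p q w where "separates p N1 N2" "separates q N1 N3" "separates w N2 N3"
    using exists_separating_idempotent N by metis
  then have p: "p \<in> carrier S" "p \<in> N1" "\<one> \<ominus> p \<in> N2" "p \<otimes> (\<one> \<ominus> p) \<in> J"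
    and q: "q \<in> carrier S" "q \<in> N1" "\<one> \<ominus> q \<in> N3" "q \<otimes> (\<one> \<ominus> q) \<in> J"
    and w: "w \<in> carrier S" "w \<in> N2" "\<one> \<ominus> w \<in> N3" "w \<otimes> (\<one> \<ominus> w) \<in> J"
    by (auto simp: separates_def)
  note E1 = idealE[OF maximalideal.axioms(1)[OF N(1)]]
  note E2 = idealE[OF maximalideal.axioms(1)[OF N(2)]]
  note E3 = idealE[OF maximalideal.axioms(1)[OF N(3)]]
  have compl: "(\<one> \<ominus> g) \<otimes> (\<one> \<ominus> (\<one> \<ominus> g)) \<in> J"
    if "g \<in> carrier S" "g \<otimes> (\<one> \<ominus> g) \<in> J" for g
  proof -
    have "(\<one> \<ominus> g) \<otimes> (\<one> \<ominus> (\<one> \<ominus> g)) = g \<otimes> (\<one> \<ominus> g)" using that(1) by algebra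
    then show ?thesis using that(2) by simp
  qed
  define e f where "e = (\<one> \<ominus> p) \<otimes> (\<one> \<ominus> q)" and "f = q \<otimes> w"
  have c: "e \<in> carrier S" "f \<in> carrier S" using p q w by (auto simp: e_def f_def)
  have e_idem: "e \<otimes> (\<one> \<ominus> e) \<in> J"
    unfolding e_def by (intro idempotent_mult compl minus_closed one_closed p q)
  have f_idem: "f \<otimes> (\<one> \<ominus> f) \<in> J"
    unfolding f_def by (intro idempotent_mult q w)
  have "e \<otimes> f = ((\<one> \<ominus> p) \<otimes> w) \<otimes> (q \<otimes> (\<one> \<ominus> q))"
    unfolding e_def f_def using p q w by algebra
  then have ef: "e \<otimes> f \<in> J"
    using JE(5)[OF q(4), of "(\<one> \<ominus> p) \<otimes> w"] p w by simp
  have "(e \<oplus> f) \<otimes> (\<one> \<ominus> (e \<oplus> f)) = (e \<otimes> (\<one> \<ominus> e) \<oplus> f \<otimes> (\<one> \<ominus> f)) \<oplus> (\<ominus> (e \<otimes> f) \<oplus> \<ominus> (e \<otimes> f))"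
    using c by algebra
  also have "\<dots> \<in> J" by (intro JE(3,4) e_idem f_idem ef)
  finally have g_idem: "(e \<oplus> f) \<otimes> (\<one> \<ominus> (e \<oplus> f)) \<in> J" .
  have "\<one> \<ominus> e = (p \<oplus> q) \<oplus> \<ominus> p \<otimes> q" unfolding e_def using p q by algebra
  moreover have "(p \<oplus> q) \<oplus> \<ominus> p \<otimes> q \<in> N1" by (intro E1(3-5) p q a_inv_closed)
  ultimately have e1: "\<one> \<ominus> e \<in> N1" by simp
  have e2: "e \<in> N2" unfolding e_def by (intro E2(6) p minus_closed one_closed q)
  have e3: "e \<in> N3" unfolding e_def by (intro E3(5) q minus_closed one_closed p)
  have f2: "f \<in> N2" unfolding f_def by (intro E2(5) q w)
  have "\<one> \<ominus> f = (\<one> \<ominus> q) \<oplus> q \<otimes> (\<one> \<ominus> w)" unfolding f_def using q w by algebra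
  moreover have "(\<one> \<ominus> q) \<oplus> q \<otimes> (\<one> \<ominus> w) \<in> N3" by (intro E3(3,5) q w)
  ultimately have f3: "\<one> \<ominus> f \<in> N3" by simp
  have "\<one> \<ominus> (e \<oplus> f) = (\<one> \<ominus> f) \<oplus> \<ominus> e" using c by algebra
  moreover have "(\<one> \<ominus> f) \<oplus> \<ominus> e \<in> N3" by (intro E3(3,4) f3 e3)
  ultimately have g3: "\<one> \<ominus> (e \<oplus> f) \<in> N3" by simp
  have g2: "e \<oplus> f \<in> N2" by (intro E2(3) e2 f2)
  have g: "e \<oplus> f \<in> carrier S" using c by simp
  note U = adjoin_subalgebra[OF c(1) e_idem] and V = adjoin_subalgebra[OF c(2) f_idem]
    and W = adjoin_subalgebra[OF g g_idem]
  note comp = compositum_props[OF V W]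
  have "subring (compositum S (adjoin f) (adjoin (e \<oplus> f))) S"
    using comp(1) by (simp add: subalgebras_def)
  moreover have "f \<in> compositum S (adjoin f) (adjoin (e \<oplus> f))"
    "e \<oplus> f \<in> compositum S (adjoin f) (adjoin (e \<oplus> f))"
    using comp(2,3) self_mem_adjoin c g by auto
  ultimately have "(e \<oplus> f) \<oplus> \<ominus> f \<in> compositum S (adjoin f) (adjoin (e \<oplus> f))"
    using subringE(5,7) by metis
  moreover have "(e \<oplus> f) \<oplus> \<ominus> f = e" using c by algebra
  ultimately have "e \<in> adjoin e \<inter> compositum S (adjoin f) (adjoin (e \<oplus> f))"
    using self_mem_adjoin[OF c(1)] by simp
  also have "\<dots> = compositum S (adjoin e \<inter> adjoin f) (adjoin e \<inter> adjoin (e \<oplus> f))"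
    using dist U V W unfolding distributive_extension_def by blast
  also have "\<dots> \<subseteq> R <+>\<^bsub>S\<^esub> J"
  proof (rule compositum_least[of _ R])
    show "adjoin e \<inter> adjoin f \<in> subalgebras R S" "adjoin e \<inter> adjoin (e \<oplus> f) \<in> subalgebras R S"
      using U V W subring_inter by (auto simp: subalgebras_def)
    show "subring (R <+>\<^bsub>S\<^esub> J) S"
      using plus_ideal_subalgebra[OF J_ideal] by (simp add: subalgebras_def)
    show "adjoin e \<inter> adjoin f \<subseteq> R <+>\<^bsub>S\<^esub> J"
      by (rule adjoin_inter[OF c N(2,3) e2 f2 e3 f3])
    show "adjoin e \<inter> adjoin (e \<oplus> f) \<subseteq> R <+>\<^bsub>S\<^esub> J"
      by (rule adjoin_inter[OF c(1) g N(2,3) e2 g2 e3 g3])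
  qed
  finally have "e \<in> R <+>\<^bsub>S\<^esub> J" .
  moreover have "separates e N2 N1" using c e1 e2 e_idem by (simp add: separates_def)
  ultimately show False using idempotent_notin_plus_J N by blast
qed

section \<open>The t-closure\<close>

lemma t_closed_imp_seminormal:
  assumes "subring B S" "t_closed B S"
  shows "seminormal B S"
  unfolding seminormal_def
proof (intro ballI impI)
  fix b assume b: "b \<in> carrier S" "b [^] (2::nat) \<in> B" "b [^] (3::nat) \<in> B"
  have "b [^] (2::nat) \<ominus> \<zero> \<otimes> b \<in> B" "b [^] (3::nat) \<ominus> \<zero> \<otimes> b [^] (2::nat) \<in> B"
    using b by (simp_all add: minus_eq)
  then show "b \<in> B"
    using assms(2) b(1) subringE(2)[OF assms(1)] unfolding t_closed_def by blast
qed

lemma seminormalization_subset_t_closure: "seminormalization R S \<subseteq> t_closure R S"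
proof -
  note t = t_closure_least[OF ring_axioms R_subring]
  have "seminormal (t_closure R S) S"
    using t_closed_imp_seminormal t(1,2) by (simp add: subalgebras_def)
  then show ?thesis
    by (rule seminormalization_least(3)[OF ring_axioms R_subring t(1)])
qed

lemma t_closure_subset_plus_maximalideal:
  assumes "maximalideal N S"
  shows "t_closure R S \<subseteq> R <+>\<^bsub>S\<^esub> N"
  using t_closure_least(3)[OF ring_axioms R_subring] plus_maximalideal_t_closed[OF assms]
    plus_ideal_subalgebra[OF maximalideal.axioms(1)[OF assms]] by blast

lemma t_closure_eq_seminormalization:
  assumes "Max_spec S = {N}"
  shows "t_closure R S = seminormalization R S"
proof -
  have "J = N" using assms by (simp add: jacobson_radical_def)
  moreover have "maximalideal N S" using assms by (auto simp: Max_spec_def)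
  ultimately show ?thesis
    using t_closure_subset_plus_maximalideal seminormalization_subset_t_closure
    unfolding seminormalization_eq by blast
qed

text \<open>
  If \<open>z\<close> has residue \<open>r\<close> at \<open>N\<close> and \<open>r'\<close> at \<open>N'\<close>, both from \<open>R\<close>, then \<open>z - (r + (r' - r) e)\<close> vanishes at \<open>N\<close>
  and at \<open>N'\<close>, so it lies in \<open>J\<close>. Conversely \<open>e\<^sup>2 - e\<close> and \<open>e\<^sup>3 - e\<^sup>2\<close> lie in \<open>J\<close>, so t-closedness with \<open>r = 1\<close>
  puts \<open>e\<close> into the t-closure.
\<close>

lemma t_closure_eq_adjoin:
  assumes spec: "Max_spec S = {N, N'}" and sep: "separates e N N'"
  shows "t_closure R S = adjoin e"
proof
  have N: "maximalideal N S" "maximalideal N' S" using spec by (auto simp: Max_spec_def)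
  have JN: "J = N \<inter> N'" using spec by (simp add: jacobson_radical_def)
  have e: "e \<in> carrier S" "e \<in> N" "\<one> \<ominus> e \<in> N'" "e \<otimes> (\<one> \<ominus> e) \<in> J"
    using sep by (auto simp: separates_def)
  note NE = idealE[OF maximalideal.axioms(1)[OF N(1)]]
  note NE' = idealE[OF maximalideal.axioms(1)[OF N(2)]]
  note t = t_closure_least[OF ring_axioms R_subring]
  have sub: "subring (t_closure R S) S" "R \<subseteq> t_closure R S" using t(1) by (auto simp: subalgebras_def)
  have J: "J \<subseteq> t_closure R S"
    using J_subset_seminormal[OF t(1)] t_closed_imp_seminormal[OF sub(1) t(2)] by blast
  show "t_closure R S \<subseteq> adjoin e"
  proof
    fix z assume "z \<in> t_closure R S"
    then have "z \<in> R <+>\<^bsub>S\<^esub> N" "z \<in> R <+>\<^bsub>S\<^esub> N'"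
      using t_closure_subset_plus_maximalideal N by auto
    then obtain r n r' n' where z: "z = r \<oplus> n" "r \<in> R" "n \<in> N"
      and z': "z = r' \<oplus> n'" "r' \<in> R" "n' \<in> N'"
      by (elim set_add_memE)
    have k: "r \<in> carrier S" "n \<in> carrier S" "r' \<in> carrier S" "n' \<in> carrier S"
      using z z' R_carr NE(1) NE'(1) by auto
    have zc: "z \<in> carrier S" using z(1) k by simp
    define x where "x = z \<oplus> (\<ominus> r \<oplus> (\<ominus> (r' \<ominus> r)) \<otimes> e)"
    have "x = n \<oplus> (\<ominus> (r' \<ominus> r)) \<otimes> e" unfolding x_def z(1) using k e(1) by algebra
    moreover have "n \<oplus> (\<ominus> (r' \<ominus> r)) \<otimes> e \<in> N"
      by (intro NE(3,5) z e a_inv_closed minus_closed k)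
    moreover have "x = n' \<oplus> (r' \<ominus> r) \<otimes> (\<one> \<ominus> e)" unfolding x_def z'(1) using k e(1) by algebra
    moreover have "n' \<oplus> (r' \<ominus> r) \<otimes> (\<one> \<ominus> e) \<in> N'"
      by (intro NE'(3,5) z' e minus_closed k)
    ultimately have "x \<in> J" using JN by auto
    moreover have "r' \<ominus> r \<in> R" using z z' RE(5,7) by (simp add: minus_eq)
    moreover have "z = r \<oplus> ((r' \<ominus> r) \<otimes> e \<oplus> x)"
      unfolding x_def using k zc e(1) by algebra
    ultimately show "z \<in> adjoin e" using mem_adjoinI[OF z(2)] by metis
  qed
  have "e [^] (2::nat) \<ominus> \<one> \<otimes> e = \<ominus> (e \<otimes> (\<one> \<ominus> e))"
    using e(1) by (simp add: numeral_2_eq_2, algebra)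
  moreover have "e [^] (3::nat) \<ominus> \<one> \<otimes> e [^] (2::nat) = \<ominus> e \<otimes> (e \<otimes> (\<one> \<ominus> e))"
    using e(1) by (simp add: numeral_2_eq_2 numeral_3_eq_3, algebra)
  ultimately have "e [^] (2::nat) \<ominus> \<one> \<otimes> e \<in> t_closure R S"
    "e [^] (3::nat) \<ominus> \<one> \<otimes> e [^] (2::nat) \<in> t_closure R S"
    using JE(4)[OF e(4)] JE(5)[OF e(4), of "\<ominus> e"] e(1) J by auto
  then have "e \<in> t_closure R S"
    using t(2) e(1) RE(3) sub(2) unfolding t_closed_def by blast
  then show "adjoin e \<subseteq> t_closure R S" by (rule adjoin_least[OF sub J])
qed

text \<open>
  Modulo \<open>J\<close> an element of \<open>C\<close> outside \<open>R + J\<close> is \<open>a + b e\<close> with \<open>b\<close> a unit of \<open>R\<close>, and this recovers \<open>e\<close>.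
\<close>

lemma adjoin_covers:
  assumes e: "e \<in> carrier S" and C: "subring C S" "R <+>\<^bsub>S\<^esub> J \<subset> C" "C \<subseteq> adjoin e"
  shows "C = adjoin e"
proof
  have RJ: "r \<oplus> x \<in> C" if "r \<in> R" "x \<in> J" for r x
    using set_add_memI[OF that] C(2) by blast
  have "r \<in> C" if "r \<in> R" for r using RJ[OF that JE(2)] R_carr[OF that] by simp
  moreover have "x \<in> C" if "x \<in> J" for x using RJ[OF RE(2) that] J_carr[OF that] by simp
  ultimately have sub: "R \<subseteq> C" "J \<subseteq> C" by auto
  note CE = subringE[OF C(1)]
  obtain c where c: "c \<in> C" "c \<notin> R <+>\<^bsub>S\<^esub> J" using C(2) by auto
  then obtain a b x where abx: "a \<in> R" "b \<in> R" "x \<in> J" "c = a \<oplus> (b \<otimes> e \<oplus> x)"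
    using C(3) mem_adjoinE by blast
  have k: "a \<in> carrier S" "b \<in> carrier S" "x \<in> carrier S" using abx R_carr J_carr by auto
  have "b \<notin> J"
  proof
    assume "b \<in> J"
    then have "b \<otimes> e \<oplus> x \<in> J" using JE(3,6) abx(3) e by simp
    then show False using c(2) set_add_memI[OF abx(1)] abx(4) by blast
  qed
  then obtain t where t: "t \<in> R" "b \<otimes> t = \<one>" using R_unit_if_not_J[OF abx(2)] by auto
  have tc: "t \<in> carrier S" using t R_carr by simp
  have "e = (b \<otimes> t) \<otimes> e" using t e by simp
  also have "\<dots> = t \<otimes> ((a \<oplus> (b \<otimes> e \<oplus> x)) \<oplus> (\<ominus> a \<oplus> \<ominus> x))" using k e tc by algebra
  also have "\<dots> \<in> C"
    unfolding abx(4)[symmetric] using sub t abx c(1) by (intro CE(5-7)) auto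
  finally show "adjoin e \<subseteq> C" by (rule adjoin_least[OF C(1) sub])
qed (rule C(3))

text \<open>
  With one maximal ideal both sides are \<open>1\<close>; with two, \<open>e\<close> separating them, the t-closure covers the
  seminormalization and both sides are \<open>2\<close>.
\<close>

lemma extension_length_seminormalization_t_closure:
  assumes "distributive_extension R S"
  shows "extension_length (seminormalization R S) (S\<lparr>carrier := t_closure R S\<rparr>) + 1 = ecard (Max_spec S)"
proof -
  note A = seminormalization_least(1)[OF ring_axioms R_subring]
  note T = t_closure_least(1)[OF ring_axioms R_subring]
  have subrings: "subring (seminormalization R S) S" "subring (t_closure R S) S"
    using A T by (auto simp: subalgebras_def)
  obtain N where N: "maximalideal N S" using exists_maximalideal by auto
  show ?thesis
  proof (cases "Max_spec S = {N}")
    case True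
    then show ?thesis
      using extension_length_self[OF ring_axioms subrings(1)] t_closure_eq_seminormalization[OF True]
      by (simp add: ecard_def one_enat_def)
  next
    case False
    then obtain N' where N': "maximalideal N' S" "N \<noteq> N'"
      using N by (auto simp: Max_spec_def)
    have spec: "Max_spec S = {N, N'}"
      using no_three_maximalideals[OF assms N N'(1)] N N' by (auto simp: Max_spec_def)
    obtain e where e: "separates e N N'"
      using exists_separating_idempotent[OF N N'] by auto
    have ec: "e \<in> carrier S" using e by (simp add: separates_def)
    have T_eq: "t_closure R S = adjoin e" by (rule t_closure_eq_adjoin[OF spec e])
    have "e \<in> t_closure R S" "e \<notin> seminormalization R S"
      using self_mem_adjoin[OF ec] T_eq idempotent_notin_plus_J[OF e N N'(1)]
      by (auto simp: seminormalization_eq)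
    then have "seminormalization R S \<subset> t_closure R S"
      using seminormalization_subset_t_closure by auto
    then have "extension_length (seminormalization R S) (S\<lparr>carrier := t_closure R S\<rparr>) = 1"
      using adjoin_covers[OF ec] unfolding T_eq seminormalization_eq
      by (intro extension_length_cover[OF ring_axioms])
         (use subrings in \<open>auto simp: T_eq seminormalization_eq\<close>)
    then show ?thesis
      using spec N'(2) by (simp add: ecard_def one_enat_def)
  qed
qed

end

theorem proposition8p1:
  fixes S :: "('a, 'b) ring_scheme" and R :: "'a set"
  assumes "cring S" and "subring R S" and "R \<subset> carrier S"
    and "integral_extension R S"
    and "distributive_extension R S"
    and "FCP_extension R S"
    and "local_ring (S\<lparr>carrier := R\<rparr>)"
  shows "extension_length R S =
      extension_length R (S\<lparr>carrier := seminormalization R S\<rparr>)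
    + extension_length (t_closure R S) S
    + ecard (Max_spec S) - 1"
proof -
  interpret local_integral_FCP_extension S R
    by (intro local_integral_FCP_extension.intro local_integral_FCP_extension_axioms.intro assms)
  let ?A = "seminormalization R S" and ?T = "t_closure R S"
  note A = seminormalization_least(1)[OF ring_axioms R_subring]
  note T = t_closure_least(1)[OF ring_axioms R_subring]
  have "subring ?A S" "R \<subseteq> ?A" "?T \<in> subalgebras ?A S"
    using A T seminormalization_subset_t_closure by (auto simp: subalgebras_def)
  have "distributive_extension ?A S"
    by (rule distributive_extension_mono[OF assms(5) \<open>R \<subseteq> ?A\<close>])
  then have "extension_length ?A S = extension_length ?A (S\<lparr>carrier := ?T\<rparr>) + extension_length ?T S"
    by (rule extension_length_additive[OF \<open>subring ?A S\<close> _ \<open>?T \<in> subalgebras ?A S\<close>])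
  moreover have "extension_length R S = extension_length R (S\<lparr>carrier := ?A\<rparr>) + extension_length ?A S"
    by (rule extension_length_additive[OF R_subring assms(5) A])
  ultimately show ?thesis
    unfolding extension_length_seminormalization_t_closure[OF assms(5), symmetric]
    by (simp add: ac_simps)
qed

end
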